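(* Let $X,Y$ be non-empty sets and let $a$ be a function from $Y$ to $X$. Let $A=\operatorname{im}(a)=\{a_i:i\in I\}$ (with $i\mapsto a_i$ injective), $\lambda_i=|a_ia^{-1}|$ for $i\in I$, $\Lambda_I=\prod_{i\in I}\lambda_i$, $\alpha=\operatorname{rank}(a)=|I|$ and $\beta=|X\setminus\operatorname{im}(a)|$. Let $P^a=\operatorname{Reg}(\mathcal T_{XY}^a)$, let $\varphi:P^a\to\mathcal T_A:f\mapsto(fa)|_A$, and let $\mathcal E_{XY}^a$ be the subsemigroup of $\mathcal T_{XY}^a$ generated by all idempotents of $\mathcal T_{XY}^a$. Then $\mathcal E_{XY}^a=\mathbb E(\mathcal T_A)\varphi^{-1}$. If $\alpha<\aleph_0$, then $\mathcal E_{XY}^a=E_a(D_\alpha^a)\cup(P^a\setminus D_\alpha^a)$, where $D_\alpha^a=\{f\in P^a:\operatorname{rank}(f)=\alpha\}$ and $E_a(D_\alpha^a)=\{f\in D_\alpha^a:f=f\star_af\}$. Further, $$\operatorname{rank}(\mathcal E_{XY}^a)=\operatorname{idrank}(\mathcal E_{XY}^a)=\begin{cases}|\mathcal E_{XY}^a|=|P^a|&\text{if }|P^a|\geq\aleph_0\\ \binom\alpha2+\max(\alpha^\beta,\Lambda_I)&\text{if }|P^a|<\aleph_0.\end{cases}$$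
   Context: Maps are written on the right and composed left to right. $\mathcal T_{XY}$ is the set of all (totally defined) functions $X\to Y$; $\mathcal T_{XY}^a$ is the sandwich semigroup $(\mathcal T_{XY},\star_a)$ with $f\star_ag=fag$, whose idempotents are the $f$ with $f=faf$; $\operatorname{Reg}(\mathcal T_{XY}^a)$ is the set of its regular elements (those $f$ with $f=f\star_ag\star_af$ for some $g$), which is a subsemigroup. $\mathcal T_A$ is the full transformation semigroup on $A$; $\varphi$ is a surjective homomorphism; $\mathbb E(\mathcal T_A)$ is the subsemigroup of $\mathcal T_A$ generated by its idempotents, and $\mathbb E(\mathcal T_A)\varphi^{-1}$ is its preimage under $\varphi$. For a function, $\operatorname{rank}(f)=|\operatorname{im}(f)|$; for a semigroup $T$, $\operatorname{rank}(T)$ is the least cardinality of a generating set (as a semigroup), and for an idempotent-generated semigroup $T$, $\operatorname{idrank}(T)$ is the least cardinality of a generating set consisting of idempotents. $\binom12=0$.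
   Formalization: For α=2 with P^a finite the printed formula fails (X=Y={0,1}, a=id: rank 3, not 2); there the formal statement has 2+max(α^β,Λ_I) in place of binom(α,2)+max(α^β,Λ_I). All other cases are as stated. *)

theory Defs
  imports Complex_Main "HOL-Library.FuncSet"
begin

unbundle cardinal_syntax

text \<open>
  Semigroups are given by a carrier set and a multiplication. Maps act on the right in the source,
  so a product \<open>fg\<close> is \<open>compose X g f\<close> here (first \<open>f\<close>, then \<open>g\<close>).
\<close>

inductive_set subsemigroup_gen :: "('s \<Rightarrow> 's \<Rightarrow> 's) \<Rightarrow> 's set \<Rightarrow> 's set"
  for m :: "'s \<Rightarrow> 's \<Rightarrow> 's" and G :: "'s set" where
  incl: "x \<in> G \<Longrightarrow> x \<in> subsemigroup_gen m G"
| mult: "x \<in> subsemigroup_gen m G \<Longrightarrow> y \<in> subsemigroup_gen m G \<Longrightarrow> m x y \<in> subsemigroup_gen m G"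

definition idempotents :: "('s \<Rightarrow> 's \<Rightarrow> 's) \<Rightarrow> 's set \<Rightarrow> 's set" where
  "idempotents m S = {x \<in> S. x = m x x}"

definition regular_elements :: "('s \<Rightarrow> 's \<Rightarrow> 's) \<Rightarrow> 's set \<Rightarrow> 's set" where
  "regular_elements m S = {x \<in> S. \<exists>y \<in> S. x = m (m x y) x}"

definition idempotent_generated :: "('s \<Rightarrow> 's \<Rightarrow> 's) \<Rightarrow> 's set \<Rightarrow> 's set" where
  "idempotent_generated m S = subsemigroup_gen m (idempotents m S)"

text \<open>
  The least cardinality of a member of a family of sets, as a cardinal (a well-order, to be compared
  with other cardinals by \<open>=o\<close> and \<open>\<le>o\<close>). It is attained whenever the family is non-empty.
\<close>

definition least_cardinality :: "'s set set \<Rightarrow> 's rel" where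
  "least_cardinality F = |SOME G. G \<in> F \<and> (\<forall>H \<in> F. |G| \<le>o |H| )|"

lemma least_cardinality_attained:
  assumes "F \<noteq> {}"
  obtains G where "G \<in> F" "least_cardinality F = |G|" "\<And>H. H \<in> F \<Longrightarrow> |G| \<le>o |H|"
proof -
  have *: "card_of ` F \<noteq> {}" "\<forall>r \<in> card_of ` F. Card_order r"
    using assms by (auto intro: card_of_Card_order)
  from exists_minim_Card_order[OF *]
  obtain r where "r \<in> card_of ` F" "\<forall>r' \<in> card_of ` F. r \<le>o r'" by (rule bexE)
  then have "\<exists>G. G \<in> F \<and> (\<forall>H \<in> F. |G| \<le>o |H| )" by blast
  note G = someI_ex[OF this]
  show thesis
    by (rule that[OF conjunct1[OF G] least_cardinality_def]) (rule bspec[OF conjunct2[OF G]])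
qed

definition semigroup_rank :: "('s \<Rightarrow> 's \<Rightarrow> 's) \<Rightarrow> 's set \<Rightarrow> 's rel" where
  "semigroup_rank m T = least_cardinality {G. G \<subseteq> T \<and> subsemigroup_gen m G = T}"

text \<open>Only meaningful if \<open>T\<close> is generated by its idempotents.\<close>

definition semigroup_idrank :: "('s \<Rightarrow> 's \<Rightarrow> 's) \<Rightarrow> 's set \<Rightarrow> 's rel" where
  "semigroup_idrank m T = least_cardinality {G. G \<subseteq> idempotents m T \<and> subsemigroup_gen m G = T}"

text \<open>
  The set of all functions from \<open>X\<close> to \<open>Y\<close> is \<open>X \<rightarrow>\<^sub>E Y\<close>, so that each function is represented by
  exactly one element. The multiplication of the full transformation semigroup on \<open>A\<close>:
\<close>

definition trans_mult :: "'x set \<Rightarrow> ('x \<Rightarrow> 'x) \<Rightarrow> ('x \<Rightarrow> 'x) \<Rightarrow> 'x \<Rightarrow> 'x" where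
  "trans_mult A f g = compose A g f"

definition sandwich_mult ::
    "'x set \<Rightarrow> ('y \<Rightarrow> 'x) \<Rightarrow> ('x \<Rightarrow> 'y) \<Rightarrow> ('x \<Rightarrow> 'y) \<Rightarrow> 'x \<Rightarrow> 'y" where
  "sandwich_mult X a f g = compose X g (compose X a f)"

text \<open>The map \<open>f \<mapsto> (fa)|\<^sub>A\<close>, where \<open>A\<close> is the image of \<open>a\<close>.\<close>

definition sandwich_phi :: "'y set \<Rightarrow> ('y \<Rightarrow> 'x) \<Rightarrow> ('x \<Rightarrow> 'y) \<Rightarrow> 'x \<Rightarrow> 'x" where
  "sandwich_phi Y a f = compose (a ` Y) a f"

text \<open>
  The power \<open>|A|\<^bsup>|B|\<^esup>\<close> when it is finite. As it counts the maps from \<open>B\<close> to \<open>A\<close>, it has the right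
  value even if \<open>B\<close> is infinite and \<open>|A| = 1\<close>, a case which does occur below.
\<close>

definition card_power :: "'a set \<Rightarrow> 'b set \<Rightarrow> nat" where
  "card_power A B = card (B \<rightarrow>\<^sub>E A)"

text \<open>
  Pitfall for the finite rank formula: let \<open>\<alpha> = |A|\<close>. Below the top rank, \<open>\<alpha> choose 2\<close> extra
  generators are needed, except that for \<open>\<alpha> = 2\<close> there are \<open>2\<close> of them rather than \<open>1\<close>: the
  constant maps are right zeros and fall into two classes, neither of which generates the other.
  For instance, for \<open>X = Y\<close> with two elements and \<open>a\<close> the identity, the idempotents are the identity
  and both constants, they form a semigroup of rank \<open>3\<close>, and \<open>(2 choose 2) + 1 = 2\<close>.
\<close>

end

theory Submission
  imports Defs
begin

text \<open>
  The map \<open>\<phi>\<close> reflects factorizations: whenever \<open>\<phi> f = g\<^sub>1 g\<^sub>2\<close>, the factors lift to a factorization of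
  \<open>f\<close>. So the preimage of the semigroup generated by \<open>G\<close> is generated by the preimage of \<open>G\<close>, and \<open>\<E>\<close> is
  the preimage of \<open>\<langle>E(\<T>\<^sub>A)\<rangle>\<close>.
  The preimage \<open>F\<close> of the identity is a rectangular band with \<open>\<alpha>\<^sup>\<beta>\<close> rows and \<open>\<Lambda>\<^sub>I\<close> columns. If \<open>A\<close> is
  finite, then \<open>\<E> - F\<close> is an ideal of \<open>\<E>\<close>, so a generating set meets every row and every column of \<open>F\<close>.
  Every other fibre of \<open>\<phi>\<close> over \<open>\<langle>E(\<T>\<^sub>A)\<rangle>\<close> is swept out by multiplying one of its elements on both sides
  by \<open>F\<close>, so what is needed besides \<open>F\<close> is a lift of a generating set of the singular part of \<open>\<T>\<^sub>A\<close>;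
  by Howie, this takes one idempotent for each of the \<open>\<alpha> choose 2\<close> kernels of defect one (\<open>\<alpha> \<ge> 3\<close>).
  For infinite \<open>P\<close>, counting gives \<open>|P| \<le> |\<T>\<^sub>A \<times> F|\<close>. If \<open>A\<close> is finite, then \<open>|P| = |F|\<close> and already
  generating \<open>F\<close> takes \<open>|F|\<close> elements. If \<open>A\<close> is infinite, then \<open>\<T>\<^sub>A\<close> has as many idempotents as elements,
  so \<open>|P| = |\<E>|\<close>, and this is uncountable.
\<close>

section \<open>Cardinalities and generated subsemigroups\<close>

lemma least_cardinality_eq:
  assumes "\<And>G. G \<in> F \<Longrightarrow> |B| \<le>o |G|" and "G0 \<in> F" and "|G0| \<le>o |B|"
  shows "least_cardinality F =o |B|"
proof -
  from assms(2) have "F \<noteq> {}" by auto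
  then obtain G where G: "G \<in> F" "least_cardinality F = |G|" "\<And>H. H \<in> F \<Longrightarrow> |G| \<le>o |H|"
    using least_cardinality_attained by blast
  from G(3)[OF assms(2)] assms(3) have "|G| \<le>o |B|"
    by (rule ordLeq_transitive)
  with assms(1)[OF G(1)] G(2) show ?thesis
    by (simp add: ordIso_iff_ordLeq)
qed

lemma finite_ordLeq_infinite:
  assumes "finite A" and "infinite B"
  shows "|A| \<le>o |B|"
  using assms ordLeq_total[OF card_of_Well_order card_of_Well_order] card_of_ordLeq_finite by blast

lemma subsemigroup_gen_mono:
  assumes "G \<subseteq> H"
  shows "subsemigroup_gen m G \<subseteq> subsemigroup_gen m H"
proof
  fix x assume "x \<in> subsemigroup_gen m G"
  then show "x \<in> subsemigroup_gen m H"
    by induction (use assms in \<open>auto intro: subsemigroup_gen.intros\<close>)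
qed

lemma subsemigroup_gen_least:
  assumes "G \<subseteq> T" and "\<And>x y. x \<in> T \<Longrightarrow> y \<in> T \<Longrightarrow> m x y \<in> T"
  shows "subsemigroup_gen m G \<subseteq> T"
proof
  fix x assume "x \<in> subsemigroup_gen m G"
  then show "x \<in> T" by induction (use assms in auto)
qed

lemma subsemigroup_gen_subset_gen:
  assumes "G \<subseteq> subsemigroup_gen m H"
  shows "subsemigroup_gen m G \<subseteq> subsemigroup_gen m H"
  using assms by (rule subsemigroup_gen_least) (rule subsemigroup_gen.mult)

text \<open>The generated subsemigroup lies in a countable union of stages, each adding all products
  of two elements of the stage before; neither squaring nor a countable union leaves an infinite
  cardinal bound.\<close>

lemma card_of_subsemigroup_gen:
  assumes "infinite B" and "|G| \<le>o |B|"
  shows "|subsemigroup_gen m G| \<le>o |B|"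
proof -
  define L where "L n = ((\<lambda>S. S \<union> case_prod m ` (S \<times> S)) ^^ n) G" for n
  have L0: "L 0 = G" and LS: "L (Suc n) = L n \<union> case_prod m ` (L n \<times> L n)" for n
    by (simp_all add: L_def)
  have card_L: "|L n| \<le>o |B|" for n
  proof (induction n)
    case 0
    show ?case using assms(2) by (simp add: L0)
  next
    case (Suc n)
    have "|L n \<times> L n| \<le>o |B|"
      using card_of_Sigma_ordLeq_infinite[OF assms(1) Suc, of "\<lambda>_. L n"] Suc by simp
    then have "|case_prod m ` (L n \<times> L n)| \<le>o |B|"
      using card_of_image ordLeq_transitive by blast
    then show ?case
      unfolding LS
      using card_of_Un_ordLeq_infinite_Field[of "|B|"] assms(1) Suc card_of_Card_order
      by (metis Field_card_of)
  qed
  have "mono L"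
    by (rule incseq_SucI) (simp add: LS)
  have "subsemigroup_gen m G \<subseteq> (\<Union>n. L n)"
  proof (rule subsemigroup_gen_least)
    show "G \<subseteq> (\<Union>n. L n)" using L0 by blast
  next
    fix x y assume "x \<in> (\<Union>n. L n)" "y \<in> (\<Union>n. L n)"
    then obtain i j where "x \<in> L i" "y \<in> L j" by auto
    then have "x \<in> L (max i j)" "y \<in> L (max i j)"
      using monoD[OF \<open>mono L\<close>, of i "max i j"] monoD[OF \<open>mono L\<close>, of j "max i j"] by auto
    then have "m x y \<in> L (Suc (max i j))" unfolding LS by force
    then show "m x y \<in> (\<Union>n. L n)" by blast
  qed
  moreover have "|\<Union>n. L n| \<le>o |B|"
    using card_of_UNION_ordLeq_infinite[OF assms(1)] card_L assms(1) infinite_iff_card_of_nat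
    by blast
  ultimately show ?thesis
    using card_of_mono1 ordLeq_transitive by blast
qed

lemma card_le_ordLeq:
  assumes "finite A" "finite B" "card A \<le> card B"
  shows "|A| \<le>o |B|"
  using inj_on_iff_card_le[OF assms(1,2)] assms(3) card_of_ordLeq by blast

text \<open>This lets the rows and the columns of a rectangular band share one index range, the
  larger of their two numbers; surplus indices repeat a fixed element.\<close>

lemma surjection_from_lessThan:
  assumes "finite B" "B \<noteq> {}" "card B \<le> n"
  obtains p where "p ` {..<n} = B"
proof -
  obtain b where "b \<in> B" using assms(2) by blast
  obtain h where h: "bij_betw h {..<card B} B"
    using ex_bij_betw_nat_finite[OF assms(1)] by (auto simp: atLeast0LessThan)
  have "(\<lambda>i. if i < card B then h i else b) ` {..<n} = B"
  proof
    show "(\<lambda>i. if i < card B then h i else b) ` {..<n} \<subseteq> B"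
      using h \<open>b \<in> B\<close> by (auto simp: bij_betw_def)
    show "B \<subseteq> (\<lambda>i. if i < card B then h i else b) ` {..<n}"
    proof
      fix c assume "c \<in> B"
      then obtain i where "i < card B" "c = h i" using h by (auto simp: bij_betw_def)
      then show "c \<in> (\<lambda>i. if i < card B then h i else b) ` {..<n}"
        using assms(3) by (intro image_eqI[of _ _ i]) auto
    qed
  qed
  then show thesis by (rule that)
qed

section \<open>Singular maps of a finite set as products of idempotents\<close>

lemma trans_mult_apply [simp]: "x \<in> A \<Longrightarrow> trans_mult A f g x = g (f x)"
  by (simp add: trans_mult_def compose_def)

lemma trans_mult_in:
  "f \<in> A \<rightarrow>\<^sub>E A \<Longrightarrow> g \<in> A \<rightarrow>\<^sub>E A \<Longrightarrow> trans_mult A f g \<in> A \<rightarrow>\<^sub>E A"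
  unfolding trans_mult_def compose_def by (intro restrict_PiE_iff[THEN iffD2]) auto

lemma trans_mult_eqI:
  assumes "h \<in> A \<rightarrow>\<^sub>E A" and "\<And>z. z \<in> A \<Longrightarrow> g (f z) = h z"
  shows "trans_mult A f g = h"
proof (rule extensionalityI[of _ A])
  show "trans_mult A f g \<in> extensional A" by (simp add: trans_mult_def)
  show "h \<in> extensional A" using assms(1) by (simp add: PiE_iff)
qed (simp add: assms(2))

text \<open>For distinct \<open>x\<close> and \<open>y\<close> in \<open>A\<close> these are the
  idempotents of defect one: only \<open>x\<close> is missing from the image.\<close>

definition collapse :: "'a set \<Rightarrow> 'a \<Rightarrow> 'a \<Rightarrow> 'a \<Rightarrow> 'a" where
  "collapse A x y = (\<lambda>z\<in>A. if z = x then y else z)"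

lemma collapse_apply [simp]: "z \<in> A \<Longrightarrow> collapse A x y z = (if z = x then y else z)"
  by (simp add: collapse_def)

lemma collapse_in [simp]: "y \<in> A \<Longrightarrow> collapse A x y \<in> A \<rightarrow>\<^sub>E A"
  by (auto simp: collapse_def)

lemma collapse_idempotent:
  assumes "x \<in> A" "y \<in> A" "x \<noteq> y"
  shows "collapse A x y \<in> idempotents (trans_mult A) (A \<rightarrow>\<^sub>E A)"
proof -
  have "trans_mult A (collapse A x y) (collapse A x y) = collapse A x y"
    by (rule trans_mult_eqI) (use assms in auto)
  then show ?thesis using assms by (simp add: idempotents_def)
qed

definition collapses :: "'a set \<Rightarrow> ('a \<Rightarrow> 'a) set" where
  "collapses A = {collapse A x y |x y. x \<in> A \<and> y \<in> A \<and> x \<noteq> y}"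

lemma collapses_I [intro]: "x \<in> A \<Longrightarrow> y \<in> A \<Longrightarrow> x \<noteq> y \<Longrightarrow> collapse A x y \<in> collapses A"
  by (auto simp: collapses_def)

lemma collapses_subset_idempotents:
  "collapses A \<subseteq> idempotents (trans_mult A) (A \<rightarrow>\<^sub>E A)"
  by (auto simp: collapses_def intro: collapse_idempotent)

text \<open>Howie's theorem, with the idempotents of defect one as generators. The induction is on
  the number of moved points; of two points with the same value at least one is moved, so there is
  always a moved \<open>x\<close> to start from.\<close>

lemma singular_in_gen_collapses:
  assumes "finite A" and "f \<in> A \<rightarrow>\<^sub>E A" and "\<not> inj_on f A"
  shows "f \<in> subsemigroup_gen (trans_mult A) (collapses A)"
  using assms(2,3)
proof (induction "card {x \<in> A. f x \<noteq> x}" arbitrary: f rule: less_induct)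
  case less
  note fA = \<open>f \<in> A \<rightarrow>\<^sub>E A\<close>
  have fin: "finite {x \<in> A. g x \<noteq> x}" for g using assms(1) by simp
  \<comment> \<open>If \<open>f x = f y\<close>, then \<open>f\<close> is \<open>collapse A x y\<close> followed by \<open>f\<close> with any other value at \<open>x\<close>. Letting \<open>x\<close>
    be fixed decreases the measure, but may leave a permutation \<open>f'\<close>; then another moved point \<open>c\<close>
    is made fixed, and \<open>x\<close> takes over its value.\<close>
  from less.prems(2) obtain x y where xy: "x \<in> A" "y \<in> A" "x \<noteq> y" "f x = f y" "f x \<noteq> x"
    unfolding inj_on_def by metis
  define f' where "f' = f(x := x)"
  have f'A: "f' \<in> A \<rightarrow>\<^sub>E A" using fA xy by (auto simp: f'_def PiE_iff extensional_def)
  have f: "trans_mult A (collapse A x y) f' = f"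
    by (rule trans_mult_eqI[OF fA]) (use xy in \<open>auto simp: f'_def\<close>)
  show ?case
  proof (cases "inj_on f' A")
    case False
    have "{z \<in> A. f' z \<noteq> z} \<subset> {z \<in> A. f z \<noteq> z}"
      using xy(1,5) unfolding f'_def by force
    from subsemigroup_gen.mult[OF subsemigroup_gen.incl[OF collapses_I[OF xy(1-3)]]
        less.hyps[OF psubset_card_mono[OF fin this] f'A False]]
    show ?thesis unfolding f .
  next
    case True
    show ?thesis
    proof (cases "\<forall>z\<in>A. f' z = z")
      case True
      have "f = collapse A x y"
      proof (rule PiE_ext[OF fA])
        show "collapse A x y \<in> A \<rightarrow>\<^sub>E A" using xy by simp
      next
        fix z assume z: "z \<in> A"
        show "f z = collapse A x y z"
          using bspec[OF True, OF z] bspec[OF True, OF xy(2)] xy z by (cases "z = x") (simp_all add: f'_def)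
      qed
      then show ?thesis using xy by (simp add: subsemigroup_gen.incl collapses_I)
    next
      case False
      then obtain c where c: "c \<in> A" "f c \<noteq> c" "c \<noteq> x" by (auto simp: f'_def split: if_splits)
      \<comment> \<open>The permutation \<open>f'\<close> has a point \<open>d\<close> over
        \<open>c\<close>. Once \<open>c\<close> is made fixed, both \<open>c\<close> and
        \<open>d\<close> are sent to \<open>c\<close>, which keeps \<open>f''\<close> singular, as
        the induction hypothesis demands.\<close>
      have "f' ` A = A"
        using True f'A assms(1) by (intro endo_inj_surj) auto
      then obtain d where d: "d \<in> A" "f' d = c" using c(1) by (metis imageE)
      then have d': "f d = c" "d \<noteq> x" "d \<noteq> c" using c by (auto simp: f'_def split: if_splits)
      define f'' where "f'' = f(x := f c, c := c)"
      have f''A: "f'' \<in> A \<rightarrow>\<^sub>E A" using fA xy c by (auto simp: f''_def PiE_iff extensional_def)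
      have "f'' c = f'' d" using c d' by (simp add: f''_def)
      then have ninj: "\<not> inj_on f'' A" using c d d' by (auto dest: inj_onD)
      have "{z \<in> A. f'' z \<noteq> z} \<subset> {z \<in> A. f z \<noteq> z}"
        using xy(1,5) c unfolding f''_def by force
      note f'' = less.hyps[OF psubset_card_mono[OF fin this] f''A ninj]
      have f: "trans_mult A (trans_mult A (collapse A x y) (collapse A c x)) f'' = f"
        by (rule trans_mult_eqI[OF fA]) (use xy c in \<open>auto simp: f''_def\<close>)
      from subsemigroup_gen.mult[OF subsemigroup_gen.mult[OF
          subsemigroup_gen.incl[OF collapses_I[OF xy(1-3)]] subsemigroup_gen.incl[OF collapses_I[OF c(1) xy(1) c(3)]]] f'']
      show ?thesis unfolding f .
    qed
  qed
qed

section \<open>Few idempotents that generate all collapses\<close>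

lemma collapse_triangle:
  assumes "i \<in> A" "j \<in> A" "k \<in> A" "i \<noteq> j" "i \<noteq> k" "j \<noteq> k"
    and "collapse A j i \<in> subsemigroup_gen (trans_mult A) G"
    and "collapse A i k \<in> subsemigroup_gen (trans_mult A) G"
    and "collapse A k j \<in> subsemigroup_gen (trans_mult A) G"
  shows "collapse A i j \<in> subsemigroup_gen (trans_mult A) G"
proof -
  \<comment> \<open>\<open>t\<close> merges \<open>i\<close> and \<open>j\<close> and moves the two remaining values on along the cycle \<open>j \<rightarrow> i \<rightarrow> k \<rightarrow> j\<close>.\<close>
  define t where "t = trans_mult A (trans_mult A (collapse A j i) (collapse A k j)) (collapse A i k)"
  have "t \<in> subsemigroup_gen (trans_mult A) G"
    unfolding t_def by (rule subsemigroup_gen.mult[OF subsemigroup_gen.mult[OF assms(7,9)] assms(8)])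
  \<comment> \<open>\<open>t\<close> sends \<open>i\<close> and \<open>j\<close> to
    \<open>k\<close>, sends \<open>k\<close> to \<open>j\<close> and fixes the rest. It thus swaps
    \<open>j\<close> and \<open>k\<close> on its image, and its square is idempotent.\<close>
  moreover have "trans_mult A t t = collapse A i j"
    by (rule trans_mult_eqI) (use assms in \<open>auto simp: t_def\<close>)
  ultimately show ?thesis using subsemigroup_gen.mult[of t "trans_mult A" G t] by simp
qed

text \<open>Howie's tournament: one idempotent of defect one for each kernel, along the path
  \<open>0 \<rightarrow> 1 \<rightarrow> \<dots> \<rightarrow> n - 1\<close> with all other arrows going backwards.\<close>

definition tournament :: "(nat \<Rightarrow> 'a) \<Rightarrow> nat \<Rightarrow> 'a set \<Rightarrow> ('a \<Rightarrow> 'a) set" where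
  "tournament r n A = (\<lambda>(i, j). if j = Suc i then collapse A (r i) (r j) else collapse A (r j) (r i)) `
     {(i, j). i < j \<and> j < n}"

lemma card_pairs_less: "finite {(i, j). i < j \<and> j < n} \<and> card {(i, j). i < j \<and> j < (n::nat)} = n choose 2"
proof (induction n)
  case (Suc n)
  have "{(i, j). i < j \<and> j < Suc n} = {(i, j). i < j \<and> j < n} \<union> (\<lambda>i. (i, n)) ` {..<n}"
    by auto
  moreover have "card ({(i, j). i < j \<and> j < n} \<union> (\<lambda>i. (i, n)) ` {..<n}) =
      card {(i, j). i < j \<and> j < n} + card ((\<lambda>i. (i, n)) ` {..<n})"
    using Suc by (intro card_Un_disjoint) auto
  ultimately show ?case
    using Suc by (simp add: card_image inj_on_def numeral_2_eq_2)
qed simp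

lemma card_tournament: "finite (tournament r n A)" "card (tournament r n A) \<le> n choose 2"
proof -
  have fin: "finite {(i, j). i < j \<and> j < n}" and card: "card {(i, j). i < j \<and> j < n} = n choose 2"
    using card_pairs_less by auto
  show "finite (tournament r n A)" unfolding tournament_def using fin by (rule finite_imageI)
  show "card (tournament r n A) \<le> n choose 2"
    unfolding tournament_def card[symmetric] using fin by (rule card_image_le)
qed

text \<open>Reading \<open>collapse A x y\<close> as an arrow from \<open>x\<close> to
  \<open>y\<close>, \<open>collapse_triangle\<close> reverses any arrow that lies on a directed
  triangle. Every arrow missing from the tournament is obtained in this way; three vertices are the
  least that allow a triangle.\<close>

lemma collapses_in_gen_tournament:
  assumes r: "bij_betw r {..<n} A" and n: "n \<ge> 3"
  shows "collapses A \<subseteq> subsemigroup_gen (trans_mult A) (tournament r n A)"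
proof -
  define R where "R i j \<longleftrightarrow> collapse A (r i) (r j) \<in> subsemigroup_gen (trans_mult A) (tournament r n A)"
    for i j
  have rA: "r i \<in> A" if "i < n" for i using that r by (auto simp: bij_betw_def)
  have req: "r i = r j \<longleftrightarrow> i = j" if "i < n" "j < n" for i j
    using that r by (auto simp: bij_betw_def dest: inj_onD)
  have up: "R i (Suc i)" if "Suc i < n" for i
    unfolding R_def tournament_def
    by (rule subsemigroup_gen.incl, rule image_eqI[of _ _ "(i, Suc i)"]) (use that in auto)
  have down: "R j i" if "Suc i < j" "j < n" for i j
    unfolding R_def tournament_def
    by (rule subsemigroup_gen.incl, rule image_eqI[of _ _ "(i, j)"]) (use that in auto)
  have tri: "R i j" if "R j i" "R i k" "R k j" "i < n" "j < n" "k < n" "i \<noteq> j" "i \<noteq> k" "j \<noteq> k" for i j k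
    using that collapse_triangle[of "r i" A "r j" "r k"] rA req unfolding R_def by metis
  \<comment> \<open>Induction on the length of the arrow: the triangle consists of the backward
    arrow, the shorter forward arrow and the last path arrow.\<close>
  have forward: "R i (i + Suc d)" if "i + Suc d < n" for i d
    using that
  proof (induction d)
    case 0
    then show ?case using up by simp
  next
    case (Suc d)
    show ?case
    proof (rule tri[of _ _ "i + Suc d"])
      show "R (i + Suc (Suc d)) i" using Suc by (intro down) auto
      show "R i (i + Suc d)" using Suc by simp
      show "R (i + Suc d) (i + Suc (Suc d))" using up[of "i + Suc d"] Suc by simp
    qed (use Suc in auto)
  qed
  \<comment> \<open>The third vertex is \<open>i + 2\<close> where that exists and
    \<open>i - 1\<close> otherwise.\<close>
  have step_back: "R (Suc i) i" if i: "Suc i < n" for i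
  proof (cases "Suc (Suc i) < n")
    case True
    show ?thesis
      by (rule tri[of _ _ "Suc (Suc i)"]) (use True in \<open>auto intro: up down\<close>)
  next
    case False
    then obtain l where l: "i = Suc l" using i n by (cases i) auto
    show ?thesis
      by (rule tri[of _ _ l]) (use l i in \<open>auto intro: up down\<close>)
  qed
  have all: "R i j" if "i < n" "j < n" "i \<noteq> j" for i j
  proof (cases "i < j")
    case True
    then show ?thesis using forward[of i "j - i - 1"] that by simp
  next
    case False
    then show ?thesis using that step_back[of j] down[of j i] by (cases "i = Suc j") auto
  qed
  show ?thesis
  proof
    fix e assume "e \<in> collapses A"
    then obtain x y where e: "x \<in> A" "y \<in> A" "x \<noteq> y" "e = collapse A x y"
      by (auto simp: collapses_def)
    with r obtain i j where "x = r i" "y = r j" "i < n" "j < n"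
      unfolding bij_betw_def by blast
    with e all show "e \<in> subsemigroup_gen (trans_mult A) (tournament r n A)"
      unfolding R_def by auto
  qed
qed

text \<open>On two points the collapses are the two constant maps, which are right zeros, so both
  are taken; with at most one point there are none.\<close>

lemma collapses_small_generating_set:
  assumes "finite A"
  obtains T where "finite T" "T \<subseteq> collapses A"
    "card T \<le> (if card A = 2 then 2 else card A choose 2)"
    "collapses A \<subseteq> subsemigroup_gen (trans_mult A) T"
proof -
  obtain r where r: "bij_betw r {..<card A} A"
    using ex_bij_betw_nat_finite[OF assms] by (auto simp: atLeast0LessThan)
  consider "card A \<ge> 3" | "card A = 2" | "card A \<le> 1" by linarith
  then show thesis
  proof cases
    case 1
    have "tournament r (card A) A \<subseteq> collapses A"
    proof
      fix e assume "e \<in> tournament r (card A) A"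
      then obtain i j where ij: "i < j" "j < card A"
          "e = (if j = Suc i then collapse A (r i) (r j) else collapse A (r j) (r i))"
        by (auto simp: tournament_def)
      then have "r i \<in> A" "r j \<in> A" "r i \<noteq> r j"
        using r by (auto simp: bij_betw_def inj_on_def)
      then show "e \<in> collapses A" unfolding ij(3) by auto
    qed
    then show thesis
      using that[OF card_tournament(1) _ _ collapses_in_gen_tournament[OF r 1]]
        card_tournament(2)[of r "card A" A] 1 by simp
  next
    case 2
    then obtain x y where A: "A = {x, y}" "x \<noteq> y" by (auto simp: card_2_iff)
    then have "collapses A = {collapse A x y, collapse A y x}"
      by (auto simp: collapses_def)
    then have "finite (collapses A)" "card (collapses A) \<le> 2"
      by (auto simp: card_insert_if)
    then show thesis
      using that[of "collapses A"] 2 by (auto intro: subsemigroup_gen.incl)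
  next
    case 3
    then have "collapses A = {}"
      using assms by (auto simp: collapses_def card_le_Suc0_iff_eq)
    then show thesis using that[of "{}"] by auto
  qed
qed

section \<open>The idempotent-generated part of the full transformation semigroup\<close>

lemma id_idempotent: "(\<lambda>z\<in>A. z) \<in> idempotents (trans_mult A) (A \<rightarrow>\<^sub>E A)"
  using trans_mult_eqI[of "\<lambda>z\<in>A. z" A "\<lambda>z\<in>A. z" "\<lambda>z\<in>A. z"]
  by (simp add: idempotents_def)

lemma idempotent_inj_on_eq_id:
  assumes "e \<in> idempotents (trans_mult A) (A \<rightarrow>\<^sub>E A)" and "inj_on e A"
  shows "e = (\<lambda>z\<in>A. z)"
proof (rule PiE_ext[of _ A "\<lambda>_. A"])
  show "e \<in> A \<rightarrow>\<^sub>E A" using assms by (simp add: idempotents_def)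
next
  fix z assume z: "z \<in> A"
  from assms have e: "e \<in> A \<rightarrow>\<^sub>E A" "e = trans_mult A e e" by (auto simp: idempotents_def)
  then have "e (e z) = e z" using z by (metis trans_mult_apply)
  then show "e z = (\<lambda>z\<in>A. z) z" using e(1) z assms(2) by (auto dest!: inj_onD)
qed auto

text \<open>The only injective idempotent is the identity, and a product whose first factor is not
  injective is not injective either, so no other permutation is ever produced. The converse
  inclusion is \<open>singular_in_gen_collapses\<close>.\<close>

lemma idempotent_generated_trans:
  assumes "finite A"
  shows "idempotent_generated (trans_mult A) (A \<rightarrow>\<^sub>E A) =
    insert (\<lambda>z\<in>A. z) {f \<in> A \<rightarrow>\<^sub>E A. \<not> inj_on f A}"
proof (rule antisym)
  show "idempotent_generated (trans_mult A) (A \<rightarrow>\<^sub>E A) \<subseteq> insert (\<lambda>z\<in>A. z) {f \<in> A \<rightarrow>\<^sub>E A. \<not> inj_on f A}"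
    unfolding idempotent_generated_def
  proof (rule subsemigroup_gen_least)
    show "idempotents (trans_mult A) (A \<rightarrow>\<^sub>E A) \<subseteq> insert (\<lambda>z\<in>A. z) {f \<in> A \<rightarrow>\<^sub>E A. \<not> inj_on f A}"
      using idempotent_inj_on_eq_id[of _ A] by (auto simp: idempotents_def)
  next
    fix f g
    assume f: "f \<in> insert (\<lambda>z\<in>A. z) {f \<in> A \<rightarrow>\<^sub>E A. \<not> inj_on f A}"
      and g: "g \<in> insert (\<lambda>z\<in>A. z) {f \<in> A \<rightarrow>\<^sub>E A. \<not> inj_on f A}"
    then have fg: "f \<in> A \<rightarrow>\<^sub>E A" "g \<in> A \<rightarrow>\<^sub>E A" by auto
    note fgA = trans_mult_in[OF this]
    show "trans_mult A f g \<in> insert (\<lambda>z\<in>A. z) {f \<in> A \<rightarrow>\<^sub>E A. \<not> inj_on f A}"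
    proof (cases "f = (\<lambda>z\<in>A. z)")
      case True
      then have "trans_mult A f g = g"
        using fg by (intro trans_mult_eqI) auto
      then show ?thesis using g by simp
    next
      case False
      then have "\<not> inj_on (trans_mult A f g) A"
        using f by (auto simp: inj_on_def)
      then show ?thesis using fgA by simp
    qed
  qed
next
  show "insert (\<lambda>z\<in>A. z) {f \<in> A \<rightarrow>\<^sub>E A. \<not> inj_on f A} \<subseteq>
      idempotent_generated (trans_mult A) (A \<rightarrow>\<^sub>E A)"
    unfolding idempotent_generated_def
    using id_idempotent[of A] singular_in_gen_collapses[OF assms]
      subsemigroup_gen_mono[OF collapses_subset_idempotents[of A]]
    by (auto intro: subsemigroup_gen.incl)
qed

section \<open>The sandwich semigroup and its regular elements\<close>

locale sandwich =
  fixes X :: "'x set" and Y :: "'y set" and a :: "'y \<Rightarrow> 'x" and A :: "'x set"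
  assumes aYX: "a \<in> Y \<rightarrow> X" and Y_nonempty: "Y \<noteq> {}" and A_def: "A = a ` Y"
begin

abbreviation star :: "('x \<Rightarrow> 'y) \<Rightarrow> ('x \<Rightarrow> 'y) \<Rightarrow> 'x \<Rightarrow> 'y" where
  "star \<equiv> sandwich_mult X a"

abbreviation phi :: "('x \<Rightarrow> 'y) \<Rightarrow> 'x \<Rightarrow> 'x" where
  "phi \<equiv> sandwich_phi Y a"

definition P :: "('x \<Rightarrow> 'y) set" where
  "P = regular_elements star (X \<rightarrow>\<^sub>E Y)"

definition E :: "('x \<Rightarrow> 'y) set" where
  "E = idempotent_generated star (X \<rightarrow>\<^sub>E Y)"

text \<open>For finite \<open>A\<close> these are the idempotents of maximal rank, see
  \<open>idempotents_top\<close>.\<close>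

definition F :: "('x \<Rightarrow> 'y) set" where
  "F = {f \<in> P. phi f = (\<lambda>z\<in>A. z)}"

lemma A_subset: "A \<subseteq> X"
  using aYX A_def by auto

lemma A_nonempty: "A \<noteq> {}"
  using Y_nonempty A_def by auto

lemma a_in_A: "y \<in> Y \<Longrightarrow> a y \<in> A"
  using A_def by auto

lemma star_apply [simp]: "x \<in> X \<Longrightarrow> star f g x = g (a (f x))"
  by (simp add: sandwich_mult_def compose_def)

lemma star_in:
  assumes "f \<in> X \<rightarrow>\<^sub>E Y" "g \<in> X \<rightarrow>\<^sub>E Y"
  shows "star f g \<in> X \<rightarrow>\<^sub>E Y"
proof -
  have "g (a (f x)) \<in> Y" if "x \<in> X" for x
    using assms that aYX by (auto simp: PiE_iff)
  then show ?thesis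
    unfolding sandwich_mult_def compose_def by (simp add: PiE_iff)
qed

lemma star_eqI:
  assumes "h \<in> X \<rightarrow>\<^sub>E Y" and "\<And>x. x \<in> X \<Longrightarrow> g (a (f x)) = h x"
  shows "star f g = h"
proof (rule extensionalityI[of _ X])
  show "star f g \<in> extensional X" by (simp add: sandwich_mult_def)
  show "h \<in> extensional X" using assms(1) by (simp add: PiE_iff)
qed (simp add: assms(2))

lemma phi_apply [simp]: "z \<in> A \<Longrightarrow> phi f z = a (f z)"
  by (simp add: sandwich_phi_def compose_def A_def)

lemma phi_in:
  assumes "f \<in> X \<rightarrow>\<^sub>E Y"
  shows "phi f \<in> A \<rightarrow>\<^sub>E A"
proof -
  have "a (f z) \<in> A" if "z \<in> A" for z
    using assms that A_subset a_in_A by (auto simp: PiE_iff)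
  then show ?thesis
    by (simp add: sandwich_phi_def compose_def PiE_iff A_def[symmetric])
qed

lemma phi_eqI:
  assumes "h \<in> A \<rightarrow>\<^sub>E A" and "\<And>z. z \<in> A \<Longrightarrow> a (f z) = h z"
  shows "phi f = h"
proof (rule extensionalityI[of _ A])
  show "phi f \<in> extensional A" by (simp add: sandwich_phi_def A_def)
  show "h \<in> extensional A" using assms(1) by (simp add: PiE_iff)
qed (simp add: assms(2))

lemma phi_star:
  assumes "f \<in> X \<rightarrow>\<^sub>E Y" "g \<in> X \<rightarrow>\<^sub>E Y"
  shows "phi (star f g) = trans_mult A (phi f) (phi g)"
proof (rule phi_eqI)
  show "trans_mult A (phi f) (phi g) \<in> A \<rightarrow>\<^sub>E A"
    by (intro trans_mult_in phi_in assms)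
  fix z assume z: "z \<in> A"
  then have "a (f z) \<in> A" using assms(1) A_subset a_in_A by (auto simp: PiE_iff)
  then show "a (star f g z) = trans_mult A (phi f) (phi g) z"
    using z A_subset by auto
qed

text \<open>If \<open>f = fagaf\<close>, then \<open>f\<close> can be recovered from
  \<open>fa\<close>, so \<open>a\<close> is injective on the image of \<open>f\<close>; and every
  value of \<open>f\<close> is taken at a point that \<open>a\<close> produces.\<close>

lemma P_iff: "f \<in> P \<longleftrightarrow> f \<in> X \<rightarrow>\<^sub>E Y \<and> inj_on a (f ` X) \<and> f ` X = f ` A"
proof
  assume "f \<in> P"
  then obtain g where f: "f \<in> X \<rightarrow>\<^sub>E Y" and g: "g \<in> X \<rightarrow>\<^sub>E Y" and eq: "f = star (star f g) f"
    unfolding P_def regular_elements_def by blast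
  have fx: "f x = f (a (g (a (f x))))" if "x \<in> X" for x
    using fun_cong[OF eq, of x] that by simp
  have "inj_on a (f ` X)"
    by (rule inj_onI) (metis fx imageE)
  moreover have "f x \<in> f ` A" if "x \<in> X" for x
  proof (subst fx[OF that], rule imageI, rule a_in_A)
    show "g (a (f x)) \<in> Y" using f g that aYX by (auto simp: PiE_iff)
  qed
  ultimately show "f \<in> X \<rightarrow>\<^sub>E Y \<and> inj_on a (f ` X) \<and> f ` X = f ` A"
    using f A_subset by blast
next
  assume f: "f \<in> X \<rightarrow>\<^sub>E Y \<and> inj_on a (f ` X) \<and> f ` X = f ` A"
  \<comment> \<open>The inverse \<open>g\<close> sends \<open>u = a (f x)\<close> to some
    \<open>w\<close> for which \<open>f (a w) = f x\<close>. Such a \<open>w\<close> exists since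
    \<open>f x\<close> is a value on \<open>A\<close>, and it serves all \<open>x\<close> with the
    same \<open>u\<close> since \<open>a\<close> is injective on the image of \<open>f\<close>.
    Other \<open>u\<close> get an arbitrary point of \<open>Y\<close>.\<close>
  have "\<exists>w. w \<in> Y \<and> (\<forall>x\<in>X. a (f x) = u \<longrightarrow> f (a w) = f x)" for u
  proof (cases "\<exists>x\<in>X. a (f x) = u")
    case True
    then obtain x where x: "x \<in> X" "a (f x) = u" by blast
    with f have "f x \<in> f ` A" by blast
    then obtain w where "w \<in> Y" "f x = f (a w)" unfolding A_def by blast
    moreover have "f (a w) = f x'" if "x' \<in> X" "a (f x') = u" for x'
    proof -
      from f have "inj_on a (f ` X)" by blast
      then have "f x = f x'" by (rule inj_onD) (use x that in auto)
      then show ?thesis using \<open>f x = f (a w)\<close> by simp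
    qed
    ultimately show ?thesis by blast
  next
    case False
    then show ?thesis using Y_nonempty by auto
  qed
  then obtain w where w: "\<And>u. w u \<in> Y" "\<And>u x. x \<in> X \<Longrightarrow> a (f x) = u \<Longrightarrow> f (a (w u)) = f x"
    by metis
  define g where "g = (\<lambda>u\<in>X. w u)"
  have g: "g \<in> X \<rightarrow>\<^sub>E Y" using w(1) by (simp add: g_def PiE_iff)
  have "star (star f g) f = f"
  proof (rule star_eqI)
    fix x assume x: "x \<in> X"
    then have "a (f x) \<in> X" using f aYX by (auto simp: PiE_iff)
    then show "f (a (star f g x)) = f x" using x w(2) by (simp add: g_def)
  qed (use f in simp)
  then show "f \<in> P" using f g unfolding P_def regular_elements_def by force
qed

lemma P_in: "f \<in> P \<Longrightarrow> f \<in> X \<rightarrow>\<^sub>E Y"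
  by (simp add: P_iff)

lemma P_apply: "f \<in> P \<Longrightarrow> x \<in> X \<Longrightarrow> f x \<in> Y"
  by (auto dest: P_in)

lemma P_a_in_A: "f \<in> P \<Longrightarrow> x \<in> X \<Longrightarrow> a (f x) \<in> A"
  by (simp add: P_apply a_in_A)

lemma P_image: "f \<in> P \<Longrightarrow> x \<in> X \<Longrightarrow> \<exists>z\<in>A. f x = f z"
  unfolding P_iff by blast

lemma P_inj_on: "f \<in> P \<Longrightarrow> inj_on a (f ` X)"
  unfolding P_iff by blast

lemma P_inj: "f \<in> P \<Longrightarrow> x \<in> X \<Longrightarrow> x' \<in> X \<Longrightarrow> a (f x) = a (f x') \<Longrightarrow> f x = f x'"
  unfolding P_iff inj_on_def by blast

lemma star_in_P:
  assumes f: "f \<in> P" and g: "g \<in> P"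
  shows "star f g \<in> P"
  unfolding P_iff
proof (intro conjI)
  show "star f g \<in> X \<rightarrow>\<^sub>E Y" using f g by (intro star_in P_in)
  have sub: "star f g ` X \<subseteq> g ` X"
    using P_a_in_A[OF f] A_subset by auto
  show "inj_on a (star f g ` X)"
    by (rule inj_on_subset[OF P_inj_on[OF g] sub])
  show "star f g ` X = star f g ` A"
  proof
    show "star f g ` X \<subseteq> star f g ` A"
    proof
      fix y assume "y \<in> star f g ` X"
      then obtain x where x: "x \<in> X" "y = g (a (f x))" by auto
      with P_image[OF f] obtain z where "z \<in> A" "f x = f z" by blast
      then have "y = star f g z" using x A_subset by auto
      with \<open>z \<in> A\<close> show "y \<in> star f g ` A" by blast
    qed
  qed (use A_subset in auto)
qed

text \<open>Every element of \<open>P\<close> is a map \<open>k\<close> onto the image of \<open>k|\<^sub>A\<close>, followed by a section of \<open>a\<close>.\<close>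

lemma lift_in_P:
  assumes "\<And>x. x \<in> X \<Longrightarrow> k x \<in> A" and "\<And>x. x \<in> X \<Longrightarrow> \<exists>z\<in>A. k x = k z"
    and "\<And>u. u \<in> A \<Longrightarrow> s u \<in> Y" and "\<And>u. u \<in> A \<Longrightarrow> a (s u) = u"
  shows "(\<lambda>x\<in>X. s (k x)) \<in> P" and "phi (\<lambda>x\<in>X. s (k x)) = restrict k A"
proof -
  have "inj_on a ((\<lambda>x\<in>X. s (k x)) ` X)"
    by (rule inj_onI) (use assms(1,4) in auto)
  moreover have "(\<lambda>x\<in>X. s (k x)) ` X = (\<lambda>x\<in>X. s (k x)) ` A"
  proof
    show "(\<lambda>x\<in>X. s (k x)) ` X \<subseteq> (\<lambda>x\<in>X. s (k x)) ` A"
    proof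
      fix y assume "y \<in> (\<lambda>x\<in>X. s (k x)) ` X"
      then obtain x where x: "x \<in> X" "y = s (k x)" by auto
      with assms(2) obtain z where "z \<in> A" "k x = k z" by blast
      then show "y \<in> (\<lambda>x\<in>X. s (k x)) ` A" using x A_subset by (auto simp: image_iff)
    qed
  qed (use A_subset in auto)
  ultimately show "(\<lambda>x\<in>X. s (k x)) \<in> P"
    unfolding P_iff using assms(1,3) by (simp add: PiE_iff)
  show "phi (\<lambda>x\<in>X. s (k x)) = restrict k A"
    by (rule phi_eqI) (use assms A_subset in \<open>auto simp: PiE_iff\<close>)
qed

section \<open>Lifting maps and factorizations along \<open>phi\<close>\<close>

lemma section_exists:
  obtains s where "\<And>u. u \<in> A \<Longrightarrow> s u \<in> Y" and "\<And>u. u \<in> A \<Longrightarrow> a (s u) = u"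
  using that[of "inv_into Y a"] unfolding A_def by (auto simp: inv_into_into f_inv_into_f)

text \<open>A section of \<open>a\<close> with values in the image of \<open>f\<close> wherever
  possible, which is consistent because \<open>a\<close> is injective there. It makes a lift
  reproduce \<open>f\<close> itself and not only \<open>phi f\<close>.\<close>

lemma section_through:
  assumes "f \<in> P"
  obtains s where "\<And>u. u \<in> A \<Longrightarrow> s u \<in> Y" and "\<And>u. u \<in> A \<Longrightarrow> a (s u) = u"
    and "\<And>x. x \<in> X \<Longrightarrow> s (a (f x)) = f x"
proof -
  obtain s0 where s0: "\<And>u. u \<in> A \<Longrightarrow> s0 u \<in> Y" "\<And>u. u \<in> A \<Longrightarrow> a (s0 u) = u"
    using section_exists by blast
  have inj: "inj_on a (f ` X)" using assms by (rule P_inj_on)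
  define s where "s u = (if u \<in> a ` f ` X then inv_into (f ` X) a u else s0 u)" for u
  show thesis
  proof (rule that[of s])
    fix u assume u: "u \<in> A"
    have "inv_into (f ` X) a u \<in> Y" if "u \<in> a ` f ` X"
      using inv_into_into[OF that] P_apply[OF assms] by auto
    then show "s u \<in> Y" using s0(1)[OF u] by (simp add: s_def)
    show "a (s u) = u" using s0(2)[OF u] f_inv_into_f[of u a "f ` X"] by (simp add: s_def)
  next
    fix x assume "x \<in> X"
    then show "s (a (f x)) = f x" using inj by (simp add: s_def inv_into_f_f)
  qed
qed

lemma phi_surj:
  assumes "g \<in> A \<rightarrow>\<^sub>E A"
  obtains f where "f \<in> P" "phi f = g"
proof -
  obtain s where s: "\<And>u. u \<in> A \<Longrightarrow> s u \<in> Y" "\<And>u. u \<in> A \<Longrightarrow> a (s u) = u"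
    using section_exists by blast
  obtain z0 where z0: "z0 \<in> A" using A_nonempty by blast
  \<comment> \<open>Off \<open>A\<close> the map repeats a value taken on \<open>A\<close>, as
    membership in \<open>P\<close> requires.\<close>
  define k where "k x = (if x \<in> A then g x else g z0)" for x
  have k: "k x \<in> A" "\<exists>z\<in>A. k x = k z" for x
    using assms z0 by (auto simp: k_def PiE_iff)
  have "restrict k A = g"
    using assms by (intro extensionalityI[of _ A]) (auto simp: k_def PiE_iff)
  then show thesis
    using that lift_in_P[of k s, OF k s] by simp
qed

text \<open>The first lift carries the behaviour of \<open>f\<close> off \<open>A\<close>, the
  second its choice of preimages under \<open>a\<close>: \<open>f1\<close> first retracts
  \<open>X\<close> to \<open>A\<close> by a map that leaves \<open>f\<close> unchanged modulo
  \<open>a\<close>, and \<open>f2\<close> ends with a section through \<open>f\<close>.\<close>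

lemma phi_split:
  assumes f: "f \<in> P" and g: "g1 \<in> A \<rightarrow>\<^sub>E A" "g2 \<in> A \<rightarrow>\<^sub>E A" and eq: "phi f = trans_mult A g1 g2"
  obtains f1 f2 where "f1 \<in> P" "f2 \<in> P" "phi f1 = g1" "phi f2 = g2" "f = star f1 f2"
proof -
  obtain s0 where s0: "\<And>u. u \<in> A \<Longrightarrow> s0 u \<in> Y" "\<And>u. u \<in> A \<Longrightarrow> a (s0 u) = u"
    using section_exists by blast
  obtain s where s: "\<And>u. u \<in> A \<Longrightarrow> s u \<in> Y" "\<And>u. u \<in> A \<Longrightarrow> a (s u) = u"
      "\<And>x. x \<in> X \<Longrightarrow> s (a (f x)) = f x"
    using section_through[OF f] by blast
  obtain z0 where z0: "z0 \<in> A" using A_nonempty by blast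
  \<comment> \<open>Every value of \<open>f\<close> is taken on \<open>A\<close>; for
    \<open>x\<close> in \<open>A\<close> the witness is \<open>x\<close> itself, so that the
    retraction \<open>w\<close> does not disturb \<open>phi\<close>.\<close>
  have "\<exists>z\<in>A. (x \<in> A \<longrightarrow> z = x) \<and> g2 (g1 z) = a (f x)" if x: "x \<in> X" for x
  proof -
    from P_image[OF f x] obtain z where z: "z \<in> A" "f x = f z" "x \<in> A \<longrightarrow> z = x" by metis
    then have "g2 (g1 z) = a (f x)" using fun_cong[OF eq, of z] by simp
    with z show ?thesis by blast
  qed
  then obtain w where w: "\<And>x. x \<in> X \<Longrightarrow> w x \<in> A" "\<And>x. x \<in> A \<Longrightarrow> w x = x"
      "\<And>x. x \<in> X \<Longrightarrow> g2 (g1 (w x)) = a (f x)"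
    using A_subset by (metis subsetD)
  define k1 where "k1 x = g1 (w x)" for x
  define k2 where "k2 x = (if x \<in> A then g2 x else g2 z0)" for x
  have k1: "k1 x \<in> A" "\<exists>z\<in>A. k1 x = k1 z" if "x \<in> X" for x
    using w(1,2) that g(1) by (auto simp: k1_def PiE_iff)
  have k2: "k2 x \<in> A" "\<exists>z\<in>A. k2 x = k2 z" for x
    using z0 g(2) by (auto simp: k2_def PiE_iff)
  note f1 = lift_in_P[of k1 s0, OF k1 s0] and f2 = lift_in_P[of k2 s, OF k2 s(1,2)]
  show thesis
  proof (rule that[OF f1(1) f2(1)])
    have "restrict k1 A = g1"
      using g(1) w(2) by (intro extensionalityI[of _ A]) (auto simp: k1_def PiE_iff)
    with f1(2) show "phi (\<lambda>x\<in>X. s0 (k1 x)) = g1" by simp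
    have "restrict k2 A = g2"
      using g(2) by (intro extensionalityI[of _ A]) (auto simp: k2_def PiE_iff)
    with f2(2) show "phi (\<lambda>x\<in>X. s (k2 x)) = g2" by simp
    show "f = star (\<lambda>x\<in>X. s0 (k1 x)) (\<lambda>x\<in>X. s (k2 x))"
    proof (rule star_eqI[symmetric, OF P_in[OF f]])
      fix x assume x: "x \<in> X"
      have "a (s0 (k1 x)) = k1 x" "k1 x \<in> A" using k1(1) x s0(2) by auto
      then show "(\<lambda>x\<in>X. s (k2 x)) (a ((\<lambda>x\<in>X. s0 (k1 x)) x)) = f x"
        using x A_subset w(3)[OF x] s(3)[OF x] by (auto simp: k2_def k1_def)
    qed
  qed
qed

text \<open>Two elements of one fibre differ only off \<open>A\<close> and in the section of
  \<open>a\<close> they use. A retraction to \<open>A\<close> in front corrects the former, a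
  section through \<open>f\<close> behind corrects the latter, and both are lifts of the
  identity.\<close>

lemma phi_fibre_sandwich:
  assumes f: "f \<in> P" and f0: "f0 \<in> P" and eq: "phi f = phi f0"
  obtains u v where "u \<in> F" "v \<in> F" "f = star (star u f0) v"
proof -
  obtain s0 where s0: "\<And>u. u \<in> A \<Longrightarrow> s0 u \<in> Y" "\<And>u. u \<in> A \<Longrightarrow> a (s0 u) = u"
    using section_exists by blast
  obtain s where s: "\<And>u. u \<in> A \<Longrightarrow> s u \<in> Y" "\<And>u. u \<in> A \<Longrightarrow> a (s u) = u"
      "\<And>x. x \<in> X \<Longrightarrow> s (a (f x)) = f x"
    using section_through[OF f] by blast
  obtain z0 where z0: "z0 \<in> A" using A_nonempty by blast
  have eq': "a (f0 z) = a (f z)" if "z \<in> A" for z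
    using fun_cong[OF eq, of z] that by simp
  have "\<exists>z\<in>A. (x \<in> A \<longrightarrow> z = x) \<and> a (f0 z) = a (f x)" if x: "x \<in> X" for x
  proof -
    from P_image[OF f x] obtain z where z: "z \<in> A" "f x = f z" "x \<in> A \<longrightarrow> z = x" by metis
    then show ?thesis using eq' by metis
  qed
  then obtain w where w: "\<And>x. x \<in> X \<Longrightarrow> w x \<in> A" "\<And>x. x \<in> A \<Longrightarrow> w x = x"
      "\<And>x. x \<in> X \<Longrightarrow> a (f0 (w x)) = a (f x)"
    using A_subset by (metis subsetD)
  define k where "k x = (if x \<in> A then x else z0)" for x
  have w': "\<exists>z\<in>A. w x = w z" if "x \<in> X" for x using w(1,2) that by metis
  have k: "k x \<in> A" "\<exists>z\<in>A. k x = k z" for x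
    using z0 by (auto simp: k_def)
  note u = lift_in_P[of w s0, OF w(1) w' s0] and v = lift_in_P[of k s, OF k s(1,2)]
  show thesis
  proof (rule that)
    show "(\<lambda>x\<in>X. s0 (w x)) \<in> F"
      unfolding F_def using u w(2) by (simp cong: restrict_cong)
    show "(\<lambda>x\<in>X. s (k x)) \<in> F"
      unfolding F_def using v by (simp add: k_def cong: restrict_cong)
    show "f = star (star (\<lambda>x\<in>X. s0 (w x)) f0) (\<lambda>x\<in>X. s (k x))"
    proof (rule star_eqI[symmetric, OF P_in[OF f]])
      fix x assume x: "x \<in> X"
      have "a (s0 (w x)) = w x" using w(1) x s0(2) by auto
      then show "(\<lambda>x\<in>X. s (k x)) (a (star (\<lambda>x\<in>X. s0 (w x)) f0 x)) = f x"
        using x A_subset w(3)[OF x] s(3)[OF x] P_a_in_A[OF f x] by (auto simp: k_def)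
    qed
  qed
qed

lemma phi_vimage_gen:
  assumes "G \<subseteq> A \<rightarrow>\<^sub>E A"
  shows "{f \<in> P. phi f \<in> subsemigroup_gen (trans_mult A) G} = subsemigroup_gen star {f \<in> P. phi f \<in> G}"
proof (intro antisym subsemigroup_gen_least)
  \<comment> \<open>The claim covers all lifts of \<open>g\<close>, because \<open>phi_split\<close>
    dictates which lifts of the factors occur.\<close>
  have "\<forall>f. f \<in> P \<longrightarrow> phi f = g \<longrightarrow> f \<in> subsemigroup_gen star {f \<in> P. phi f \<in> G}"
    if "g \<in> subsemigroup_gen (trans_mult A) G" for g
    using that
  proof induction
    case (incl g)
    then show ?case by (auto intro: subsemigroup_gen.incl)
  next
    case (mult g1 g2)
    have g: "g1 \<in> A \<rightarrow>\<^sub>E A" "g2 \<in> A \<rightarrow>\<^sub>E A"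
      using subsetD[OF subsemigroup_gen_least[of G _ "trans_mult A", OF assms trans_mult_in]] mult.hyps
      by blast+
    show ?case
    proof (intro allI impI)
      fix f assume "f \<in> P" "phi f = trans_mult A g1 g2"
      from phi_split[OF this(1) g this(2)] obtain f1 f2
        where f: "f1 \<in> P" "f2 \<in> P" "phi f1 = g1" "phi f2 = g2" "f = star f1 f2" .
      show "f \<in> subsemigroup_gen star {f \<in> P. phi f \<in> G}"
        unfolding f(5) using mult.IH f(1-4) by (simp add: subsemigroup_gen.mult)
    qed
  qed
  then show "{f \<in> P. phi f \<in> subsemigroup_gen (trans_mult A) G} \<subseteq> subsemigroup_gen star {f \<in> P. phi f \<in> G}"
    by blast
next
  show "{f \<in> P. phi f \<in> G} \<subseteq> {f \<in> P. phi f \<in> subsemigroup_gen (trans_mult A) G}"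
    by (auto intro: subsemigroup_gen.incl)
next
  fix x y
  assume "x \<in> {f \<in> P. phi f \<in> subsemigroup_gen (trans_mult A) G}"
    and "y \<in> {f \<in> P. phi f \<in> subsemigroup_gen (trans_mult A) G}"
  then show "star x y \<in> {f \<in> P. phi f \<in> subsemigroup_gen (trans_mult A) G}"
    by (simp add: star_in_P phi_star P_in subsemigroup_gen.mult)
qed

section \<open>Idempotents and the subsemigroup they generate\<close>

lemma idempotents_star:
  "idempotents star (X \<rightarrow>\<^sub>E Y) = {f \<in> P. phi f \<in> idempotents (trans_mult A) (A \<rightarrow>\<^sub>E A)}"
proof (intro set_eqI iffI)
  fix f assume "f \<in> idempotents star (X \<rightarrow>\<^sub>E Y)"
  then have f: "f \<in> X \<rightarrow>\<^sub>E Y" "star f f = f" by (auto simp: idempotents_def)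
  then have "f \<in> P" unfolding P_def regular_elements_def by force
  moreover have "trans_mult A (phi f) (phi f) = phi f" using phi_star[OF f(1) f(1)] f(2) by simp
  ultimately show "f \<in> {f \<in> P. phi f \<in> idempotents (trans_mult A) (A \<rightarrow>\<^sub>E A)}"
    using phi_in[OF f(1)] by (simp add: idempotents_def)
next
  fix f assume "f \<in> {f \<in> P. phi f \<in> idempotents (trans_mult A) (A \<rightarrow>\<^sub>E A)}"
  then have f: "f \<in> P" "phi f = trans_mult A (phi f) (phi f)" by (auto simp: idempotents_def)
  \<comment> \<open>Idempotency of \<open>phi f\<close> gives the equation on \<open>A\<close> after
    applying \<open>a\<close>. Injectivity of \<open>a\<close> on the image of \<open>f\<close>
    cancels \<open>a\<close>, and points off \<open>A\<close> share their value with a point of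
    \<open>A\<close>.\<close>
  have "star f f = f"
  proof (rule star_eqI[OF P_in[OF f(1)]])
    fix x assume "x \<in> X"
    with P_image[OF f(1)] obtain z where z: "z \<in> A" "f x = f z" by blast
    then have fz: "a (f z) \<in> A" using P_a_in_A[OF f(1)] A_subset by blast
    then have "a (f (a (f z))) = a (f z)" using fun_cong[OF f(2), of z] z by simp
    then have "f (a (f z)) = f z" using P_inj[OF f(1)] fz z A_subset by blast
    then show "f (a (f x)) = f x" using z by simp
  qed
  then show "f \<in> idempotents star (X \<rightarrow>\<^sub>E Y)" using P_in[OF f(1)] by (simp add: idempotents_def)
qed

theorem E_eq: "E = {f \<in> P. phi f \<in> idempotent_generated (trans_mult A) (A \<rightarrow>\<^sub>E A)}"
  unfolding E_def idempotent_generated_def idempotents_star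
  by (rule phi_vimage_gen[symmetric]) (auto simp: idempotents_def)

lemma E_subset_P: "E \<subseteq> P"
  using E_eq by blast

lemma E_finite:
  assumes "finite A"
  shows "E = F \<union> {f \<in> P. \<not> inj_on (phi f) A}"
  unfolding E_eq idempotent_generated_trans[OF assms] F_def using phi_in[OF P_in] by blast

lemma F_inj_on: "f \<in> F \<Longrightarrow> inj_on (phi f) A"
  by (simp add: F_def inj_on_restrict_eq)

lemma F_P: "f \<in> F \<Longrightarrow> f \<in> P"
  by (simp add: F_def)

lemma F_apply: "f \<in> F \<Longrightarrow> z \<in> A \<Longrightarrow> a (f z) = z"
  unfolding F_def using phi_apply[of z f] by simp

lemma F_apply': "f \<in> F \<Longrightarrow> x \<in> X \<Longrightarrow> f (a (f x)) = f x"
  by (metis F_P F_apply P_image)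

lemma F_subset_idempotents: "F \<subseteq> idempotents star (X \<rightarrow>\<^sub>E Y)"
  using id_idempotent by (auto simp: idempotents_star F_def)

lemma idempotents_subset_E: "idempotents star (X \<rightarrow>\<^sub>E Y) \<subseteq> E"
  unfolding E_def idempotent_generated_def by (auto intro: subsemigroup_gen.incl)

lemma idempotents_E: "idempotents star E = idempotents star (X \<rightarrow>\<^sub>E Y)"
  using idempotents_subset_E E_subset_P P_in by (auto simp: idempotents_def)

lemma F_subset_E: "F \<subseteq> E"
  using F_subset_idempotents idempotents_subset_E by blast

lemma E_closed: "x \<in> E \<Longrightarrow> y \<in> E \<Longrightarrow> star x y \<in> E"
  unfolding E_def idempotent_generated_def by (rule subsemigroup_gen.mult)

lemma gen_E: "subsemigroup_gen star E = E"
  by (intro antisym subsemigroup_gen_least E_closed) (auto intro: subsemigroup_gen.incl)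

lemma gen_idempotents_E: "subsemigroup_gen star (idempotents star E) = E"
  unfolding idempotents_E unfolding E_def idempotent_generated_def ..

text \<open>As \<open>a\<close> is injective on the image of \<open>f\<close>, the maps
  \<open>f\<close> and \<open>phi f\<close> have the same rank; on a finite set full rank means
  injective.\<close>

lemma card_image_eq_iff_inj_on_phi:
  assumes "finite A" and f: "f \<in> P"
  shows "|f ` X| =o |A| \<longleftrightarrow> inj_on (phi f) A"
proof -
  have img: "f ` X = f ` A" using f unfolding P_iff by blast
  have inj: "inj_on a (f ` A)" using P_inj_on[OF f] unfolding img .
  have "phi f ` A = a ` f ` A" by (simp add: image_image)
  then have card: "card (phi f ` A) = card (f ` A)" using inj by (simp add: card_image)
  have "|f ` X| =o |A| \<longleftrightarrow> card (f ` A) = card A"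
    unfolding img card_of_ordIso[symmetric]
    using assms(1) bij_betw_same_card finite_same_card_bij[of "f ` A" A] by auto
  also have "\<dots> \<longleftrightarrow> inj_on (phi f) A"
    unfolding card[symmetric] using assms(1) card_image eq_card_imp_inj_on by blast
  finally show ?thesis .
qed

lemma idempotents_top:
  assumes "finite A"
  shows "idempotents star {f \<in> P. |f ` X| =o |A| } = F"
proof -
  have "f \<in> P \<and> inj_on (phi f) A \<and> f = star f f \<longleftrightarrow> f \<in> F" for f
  proof
    assume f: "f \<in> P \<and> inj_on (phi f) A \<and> f = star f f"
    then have "f \<in> idempotents star (X \<rightarrow>\<^sub>E Y)" by (simp add: idempotents_def P_in)
    then have "phi f \<in> idempotents (trans_mult A) (A \<rightarrow>\<^sub>E A)" by (simp add: idempotents_star)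
    then show "f \<in> F" using f idempotent_inj_on_eq_id[of "phi f" A] by (simp add: F_def)
  next
    assume "f \<in> F"
    then show "f \<in> P \<and> inj_on (phi f) A \<and> f = star f f"
      using F_subset_idempotents F_inj_on F_P by (auto simp: idempotents_def)
  qed
  then show ?thesis
    using card_image_eq_iff_inj_on_phi[OF assms] by (auto simp: idempotents_def)
qed

theorem E_eq_top:
  assumes "finite A"
  shows "E = idempotents star {f \<in> P. |f ` X| =o |A| } \<union> (P - {f \<in> P. |f ` X| =o |A| })"
  unfolding idempotents_top[OF assms] E_finite[OF assms]
  using card_image_eq_iff_inj_on_phi[OF assms] by blast

section \<open>The rectangular band over the identity\<close>

text \<open>\<open>F\<close> is a rectangular band with the two coordinates \<open>fst (coords f)\<close> and \<open>snd (coords f)\<close>.\<close>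

definition coords :: "('x \<Rightarrow> 'y) \<Rightarrow> ('x \<Rightarrow> 'x) \<times> ('x \<Rightarrow> 'y)" where
  "coords f = (\<lambda>x\<in>X - A. a (f x), restrict f A)"

definition H :: "('x \<Rightarrow> 'x) set" where
  "H = (X - A) \<rightarrow>\<^sub>E A"

definition S :: "('x \<Rightarrow> 'y) set" where
  "S = (\<Pi>\<^sub>E z\<in>A. {y \<in> Y. a y = z})"

lemma H_nonempty: "H \<noteq> {}"
  using A_nonempty by (auto simp: H_def PiE_eq_empty_iff)

lemma S_nonempty: "S \<noteq> {}"
proof -
  have "{y \<in> Y. a y = z} \<noteq> {}" if "z \<in> A" for z
    using that unfolding A_def by auto
  then show ?thesis by (simp add: S_def PiE_eq_empty_iff)
qed

lemma coords_in: "f \<in> F \<Longrightarrow> coords f \<in> H \<times> S"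
  using F_apply P_a_in_A[OF F_P] P_apply[OF F_P] A_subset by (auto simp: coords_def H_def S_def)

text \<open>Since \<open>f x = f (a (f x))\<close> on \<open>F\<close>, the first coordinate tells
  for \<open>x\<close> off \<open>A\<close> at which point of \<open>A\<close> to look up the
  second.\<close>

lemma coords_inj: "inj_on coords F"
proof (rule inj_onI)
  fix f g assume f: "f \<in> F" and g: "g \<in> F" and eq: "coords f = coords g"
  have on_A: "f z = g z" if "z \<in> A" for z
    using fun_cong[OF arg_cong[OF eq, of snd], of z] that by (simp add: coords_def)
  have a_eq: "a (f x) = a (g x)" if "x \<in> X - A" for x
    using fun_cong[OF arg_cong[OF eq, of fst], of x] that by (simp add: coords_def)
  show "f = g"
  proof (rule PiE_ext[OF P_in[OF F_P[OF f]] P_in[OF F_P[OF g]]])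
    fix x assume x: "x \<in> X"
    show "f x = g x"
    proof (cases "x \<in> A")
      case False
      then have "g (a (f x)) = g (a (g x))" using x a_eq by simp
      then show ?thesis
        using on_A[OF P_a_in_A[OF F_P[OF f] x]] F_apply'[OF f x] F_apply'[OF g x] by metis
    qed (rule on_A)
  qed
qed

lemma coords_image: "coords ` F = H \<times> S"
proof
  show "coords ` F \<subseteq> H \<times> S" using coords_in by blast
  show "H \<times> S \<subseteq> coords ` F"
  proof clarify
    fix h s assume h: "h \<in> H" and s: "s \<in> S"
    have s': "s u \<in> Y" "a (s u) = u" if "u \<in> A" for u
      using s that by (auto simp: S_def PiE_iff)
    define k where "k x = (if x \<in> A then x else h x)" for x
    have k: "k x \<in> A" "\<exists>z\<in>A. k x = k z" if "x \<in> X" for x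
      using h that by (auto simp: k_def H_def PiE_iff)
    define f where "f = (\<lambda>x\<in>X. s (k x))"
    have f: "f \<in> P" "phi f = restrict k A"
      using lift_in_P[of k s, OF k s'] unfolding f_def by simp_all
    have "f \<in> F" unfolding F_def using f by (simp add: k_def cong: restrict_cong)
    moreover have "(\<lambda>x\<in>X - A. a (f x)) = h"
      using h k(1) s' by (intro extensionalityI[of _ "X - A"]) (auto simp: f_def k_def H_def PiE_iff)
    moreover have "restrict f A = s"
      using s A_subset by (intro extensionalityI[of _ A]) (auto simp: f_def k_def S_def PiE_iff)
    ultimately show "(h, s) \<in> coords ` F" unfolding coords_def by force
  qed
qed

lemma star_in_F:
  assumes "u \<in> F" "v \<in> F"
  shows "star u v \<in> F"
proof -
  have "trans_mult A (\<lambda>z\<in>A. z) (\<lambda>z\<in>A. z) = (\<lambda>z\<in>A. z)"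
    using id_idempotent[of A] by (simp add: idempotents_def)
  then show ?thesis using assms by (simp add: F_def star_in_P phi_star P_in)
qed

lemma coords_star:
  assumes "u \<in> F" "v \<in> F"
  shows "coords (star u v) = (fst (coords u), snd (coords v))"
proof -
  have "a (star u v x) = a (u x)" if "x \<in> X - A" for x
    using that F_apply[OF assms(2)] P_a_in_A[OF F_P[OF assms(1)]] by simp
  moreover have "star u v z = v z" if "z \<in> A" for z
    using that F_apply[OF assms(1)] A_subset by auto
  ultimately show ?thesis by (simp add: coords_def cong: restrict_cong)
qed

text \<open>A product in a rectangular band keeps only the row of its first and the column of its
  last factor.\<close>

lemma gen_coords:
  assumes "f \<in> subsemigroup_gen star G" and "G \<subseteq> F"
  shows "f \<in> F \<and> (\<exists>g1\<in>G. \<exists>g2\<in>G. coords f = (fst (coords g1), snd (coords g2)))"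
  using assms(1)
proof induction
  case (incl f)
  then show ?case using assms(2) by force
next
  case (mult x y)
  then obtain g1 g2 where "g1 \<in> G" "g2 \<in> G"
    "fst (coords x) = fst (coords g1)" "snd (coords y) = snd (coords g2)" by auto
  then show ?case using mult by (auto simp: star_in_F coords_star)
qed

section \<open>Generators inside the band\<close>

lemma F_factors:
  assumes "finite A" and x: "x \<in> E" and y: "y \<in> E" and xy: "star x y \<in> F"
  shows "x \<in> F" "y \<in> F"
proof -
  have xP: "x \<in> P" and yP: "y \<in> P" using x y E_subset_P by auto
  have eq: "trans_mult A (phi x) (phi y) = (\<lambda>z\<in>A. z)"
    using xy phi_star[OF P_in[OF xP] P_in[OF yP]] by (simp add: F_def)
  have yx: "phi y (phi x z) = z" if "z \<in> A" for z
    using fun_cong[OF eq, of z] that by (simp del: phi_apply)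
  then have "inj_on (phi x) A" by (rule inj_on_inverseI)
  \<comment> \<open>Here finiteness of \<open>A\<close> enters: the identity is then the only
    permutation among the images under \<open>phi\<close> of elements of \<open>E\<close>.\<close>
  then show xF: "x \<in> F" using x unfolding E_finite[OF assms(1)] by blast
  have "phi y z = z" if "z \<in> A" for z
    using yx[OF that] F_apply[OF xF that] that by simp
  then have "phi y = (\<lambda>z\<in>A. z)"
    by (intro phi_eqI) (auto simp del: phi_apply simp: phi_apply[symmetric])
  then show "y \<in> F" using yP by (simp add: F_def)
qed

lemma F_gen:
  assumes "finite A" and G: "subsemigroup_gen star G = E"
  shows "F \<subseteq> subsemigroup_gen star (G \<inter> F)"
proof -
  have "f \<in> F \<longrightarrow> f \<in> subsemigroup_gen star (G \<inter> F)" if "f \<in> subsemigroup_gen star G" for f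
    using that
  proof induction
    case (incl f)
    then show ?case by (auto intro: subsemigroup_gen.incl)
  next
    case (mult x y)
    then show ?case using F_factors[OF assms(1)] G by (auto intro: subsemigroup_gen.mult)
  qed
  then show ?thesis using F_subset_E G by blast
qed

lemma F_coords_generators:
  assumes "finite A" and "subsemigroup_gen star G = E" and "f \<in> F"
  obtains g1 g2 where "g1 \<in> G \<inter> F" "g2 \<in> G \<inter> F" "coords f = (fst (coords g1), snd (coords g2))"
  using gen_coords[of f "G \<inter> F"] F_gen[OF assms(1,2)] assms(3) by blast

section \<open>Infinite semigroups: counting\<close>

lemma finite_A_iff_finite_endos: "finite (A \<rightarrow>\<^sub>E A) \<longleftrightarrow> finite A"
proof
  assume fin: "finite (A \<rightarrow>\<^sub>E A)"
  have "inj_on (\<lambda>z. \<lambda>u\<in>A. z) A"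
  proof (rule inj_onI)
    fix z z' assume z: "z \<in> A" and eq: "(\<lambda>u\<in>A. z) = (\<lambda>u\<in>A. z')"
    show "z = z'" using fun_cong[OF eq, of z] z by simp
  qed
  moreover have "(\<lambda>z. \<lambda>u\<in>A. z) ` A \<subseteq> A \<rightarrow>\<^sub>E A" by auto
  ultimately show "finite A" using fin by (meson finite_imageD finite_subset)
qed (rule finite_PiE)

lemma phi_image_P: "phi ` P = A \<rightarrow>\<^sub>E A"
proof
  show "phi ` P \<subseteq> A \<rightarrow>\<^sub>E A" using phi_in P_in by blast
  show "A \<rightarrow>\<^sub>E A \<subseteq> phi ` P" using phi_surj by (metis imageI subsetI)
qed

lemma finite_A: "finite P \<Longrightarrow> finite A"
  using phi_image_P finite_A_iff_finite_endos by (metis finite_imageI)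

text \<open>Besides \<open>phi f\<close>, it is enough to record one \<open>u\<close> in
  \<open>F\<close> that agrees with \<open>f\<close> off \<open>A\<close> and sends
  \<open>a (f z)\<close> to \<open>f z\<close> for \<open>z\<close> in \<open>A\<close>: on
  \<open>A\<close>, following \<open>phi f\<close> by \<open>u\<close> gives back
  \<open>f\<close>.\<close>

lemma card_of_P: "|P| \<le>o |(A \<rightarrow>\<^sub>E A) \<times> F|"
proof -
  have "\<exists>u\<in>F. (\<forall>x\<in>X - A. u x = f x) \<and> (\<forall>z\<in>A. u (a (f z)) = f z)" if f: "f \<in> P" for f
  proof -
    obtain s where s: "\<And>u. u \<in> A \<Longrightarrow> s u \<in> Y" "\<And>u. u \<in> A \<Longrightarrow> a (s u) = u"
        "\<And>x. x \<in> X \<Longrightarrow> s (a (f x)) = f x"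
      using section_through[OF f] by blast
    define k where "k x = (if x \<in> A then x else a (f x))" for x
    have k: "k x \<in> A" "\<exists>z\<in>A. k x = k z" if "x \<in> X" for x
      using P_a_in_A[OF f that] by (auto simp: k_def)
    note u = lift_in_P[of k s, OF k s(1,2)]
    show ?thesis
    proof (rule bexI[of _ "\<lambda>x\<in>X. s (k x)"])
      show "(\<lambda>x\<in>X. s (k x)) \<in> F"
        unfolding F_def using u by (simp add: k_def cong: restrict_cong)
      have "s (a (f x)) = f x" "a (f x) \<in> X" "a (f x) \<in> A" if "x \<in> X" for x
        using that s(3) P_a_in_A[OF f] A_subset by auto
      then show "(\<forall>x\<in>X - A. (\<lambda>x\<in>X. s (k x)) x = f x) \<and>
          (\<forall>z\<in>A. (\<lambda>x\<in>X. s (k x)) (a (f z)) = f z)"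
        using A_subset by (auto simp: k_def)
    qed
  qed
  then obtain u where u: "\<And>f. f \<in> P \<Longrightarrow> u f \<in> F"
      "\<And>f x. f \<in> P \<Longrightarrow> x \<in> X - A \<Longrightarrow> u f x = f x"
      "\<And>f z. f \<in> P \<Longrightarrow> z \<in> A \<Longrightarrow> u f (a (f z)) = f z"
    by metis
  have "inj_on (\<lambda>f. (phi f, u f)) P"
  proof (rule inj_onI)
    fix f g assume f: "f \<in> P" and g: "g \<in> P" and eq: "(phi f, u f) = (phi g, u g)"
    show "f = g"
    proof (rule PiE_ext[OF P_in[OF f] P_in[OF g]])
      fix x assume x: "x \<in> X"
      show "f x = g x"
      proof (cases "x \<in> A")
        case True
        have phi_eq: "phi f = phi g" and u_eq: "u f = u g" using eq by blast+
        have "a (f x) = a (g x)"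
          using fun_cong[OF phi_eq, of x] unfolding phi_apply[OF True] .
        then have "u f (a (f x)) = u g (a (g x))" unfolding u_eq by (rule arg_cong)
        then show ?thesis unfolding u(3)[OF f True] u(3)[OF g True] .
      next
        case False
        then show ?thesis using u(2)[OF f, of x] u(2)[OF g, of x] eq x by simp
      qed
    qed
  qed
  moreover have "(\<lambda>f. (phi f, u f)) ` P \<subseteq> (A \<rightarrow>\<^sub>E A) \<times> F"
    using u(1) phi_in P_in by blast
  ultimately show ?thesis
    using card_of_ordLeq by blast
qed

lemma infinite_generating_set:
  assumes "infinite P" and G: "subsemigroup_gen star G = E"
  shows "|P| \<le>o |G|"
proof (cases "finite A")
  case True
  have "infinite ((A \<rightarrow>\<^sub>E A) \<times> F)"
    using card_of_ordLeq_finite[OF card_of_P] assms(1) by blast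
  moreover have "finite (A \<rightarrow>\<^sub>E A)" using True finite_A_iff_finite_endos by blast
  ultimately have F: "infinite F" by auto
  \<comment> \<open>An element of \<open>F\<close> is determined by a generator in its row and one
    in its column, and an infinite \<open>G \<inter> F\<close> has no more pairs than
    elements.\<close>
  have "F \<subseteq> (\<lambda>(g, g'). inv_into F coords (fst (coords g), snd (coords g'))) ` ((G \<inter> F) \<times> (G \<inter> F))"
  proof
    fix f assume f: "f \<in> F"
    obtain g1 g2 where g: "g1 \<in> G \<inter> F" "g2 \<in> G \<inter> F" "coords f = (fst (coords g1), snd (coords g2))"
      using F_coords_generators[OF True G f] .
    then have "f = inv_into F coords (fst (coords g1), snd (coords g2))"
      using inv_into_f_f[OF coords_inj f] by simp
    with g show "f \<in> (\<lambda>(g, g'). inv_into F coords (fst (coords g), snd (coords g'))) ` ((G \<inter> F) \<times> (G \<inter> F))"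
      by force
  qed
  then have F_le: "|F| \<le>o |(G \<inter> F) \<times> (G \<inter> F)|" by (rule surj_imp_ordLeq)
  then have inf: "infinite (G \<inter> F)"
    using F card_of_ordLeq_finite by blast
  have "|(G \<inter> F) \<times> (G \<inter> F)| =o |G \<inter> F|"
    using card_of_Times_same_infinite[OF inf] .
  then have F_G: "|F| \<le>o |G|"
    using F_le card_of_mono1[of "G \<inter> F" G] ordLeq_ordIso_trans ordLeq_transitive by blast
  have T_F: "|A \<rightarrow>\<^sub>E A| \<le>o |F|"
    using \<open>finite (A \<rightarrow>\<^sub>E A)\<close> F by (rule finite_ordLeq_infinite)
  have T_F_F: "|(A \<rightarrow>\<^sub>E A) \<times> F| \<le>o |F|"
    using card_of_Sigma_ordLeq_infinite[OF F T_F, of "\<lambda>_. F"] ordLeq_refl[OF card_of_Card_order]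
    by blast
  show ?thesis
    by (rule ordLeq_transitive[OF card_of_P ordLeq_transitive[OF T_F_F F_G]])
next
  case False
  have T_E: "|A \<rightarrow>\<^sub>E A| \<le>o |E|"
  proof -
    have "|A \<times> {False, True}| \<le>o |A|"
      by (rule ordIso_imp_ordLeq, rule card_of_Times_infinite_simps(1)[OF False _ finite_ordLeq_infinite[OF _ False]])
        simp_all
    then obtain p where p: "inj_on p (A \<times> {False, True})" "p ` (A \<times> {False, True}) \<subseteq> A"
      unfolding card_of_ordLeq[symmetric] by blast
    have p_A: "p (z, b) \<in> A" if "z \<in> A" for z b
      using p(2) that by (cases b) auto
    have p_eq: "p (z, b) = p (z', b') \<longleftrightarrow> z = z' \<and> b = b'" if "z \<in> A" "z' \<in> A" for z z' b b'
      using inj_on_eq_iff[OF p(1), of "(z, b)" "(z', b')"] that by (cases b; cases b') auto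
    \<comment> \<open>\<open>p\<close> provides two copies of \<open>A\<close> in \<open>A\<close>; the idempotent \<open>e f\<close> maps the first to the second by \<open>f\<close>.\<close>
    define e where "e f = (\<lambda>u\<in>A. if \<exists>z\<in>A. u = p (z, True) then p (f (THE z. z \<in> A \<and> u = p (z, True)), False) else u)"
      for f
    have e1: "e f (p (z, True)) = p (f z, False)" if "z \<in> A" for f z
    proof -
      have "(THE z'. z' \<in> A \<and> p (z, True) = p (z', True)) = z"
        by (rule the_equality) (use that p_eq in auto)
      then show ?thesis using that p_A by (auto simp: e_def)
    qed
    have e2: "e f u = u" if "u \<in> A" "\<And>z. z \<in> A \<Longrightarrow> u \<noteq> p (z, True)" for f u
      using that by (auto simp: e_def)
    have e_in: "e f \<in> idempotents (trans_mult A) (A \<rightarrow>\<^sub>E A)" if f: "f \<in> A \<rightarrow>\<^sub>E A" for f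
    proof -
      have "e f u \<in> A \<and> e f (e f u) = e f u" if u: "u \<in> A" for u
      proof (cases "\<exists>z\<in>A. u = p (z, True)")
        case True
        then obtain z where z: "z \<in> A" "u = p (z, True)" by blast
        have fz: "f z \<in> A" using f z by auto
        have "e f (p (f z, False)) = p (f z, False)"
          by (rule e2) (use p_A fz p_eq in auto)
        then show ?thesis using e1[OF z(1)] z p_A fz by simp
      next
        case False
        then have "e f u = u" using u by (intro e2) auto
        then show ?thesis using u by simp
      qed
      moreover have "e f \<in> extensional A" by (simp add: e_def)
      ultimately have "e f \<in> A \<rightarrow>\<^sub>E A" "\<And>u. u \<in> A \<Longrightarrow> e f (e f u) = e f u"
        by (simp_all add: PiE_iff)
      then have "e f \<in> A \<rightarrow>\<^sub>E A" "trans_mult A (e f) (e f) = e f"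
        using trans_mult_eqI by blast+
      then show ?thesis by (simp add: idempotents_def)
    qed
    \<comment> \<open>The map \<open>f\<close> is decoded from the idempotent \<open>e f\<close> by
      comparing the two copies of \<open>A\<close>, so \<open>E\<close> has at least as many
      elements as there are self-maps of \<open>A\<close>.\<close>
    have "A \<rightarrow>\<^sub>E A \<subseteq> (\<lambda>g. \<lambda>z\<in>A. THE w. w \<in> A \<and> g (p (z, True)) = p (w, False)) ` phi ` E"
    proof
      fix f assume f: "f \<in> A \<rightarrow>\<^sub>E A"
      obtain g where g: "g \<in> P" "phi g = e f"
        using phi_surj e_in[OF f] by (auto simp: idempotents_def)
      then have "g \<in> E" using e_in[OF f] idempotents_subset_E by (auto simp: idempotents_star)
      moreover have "f = (\<lambda>z\<in>A. THE w. w \<in> A \<and> e f (p (z, True)) = p (w, False))"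
      proof (rule extensionalityI[of _ A])
        fix z assume z: "z \<in> A"
        have "f z \<in> A" using f z by auto
        then have "(THE w. w \<in> A \<and> p (f z, False) = p (w, False)) = f z"
          by (intro the_equality) (use p_eq in auto)
        then show "f z = (\<lambda>z\<in>A. THE w. w \<in> A \<and> e f (p (z, True)) = p (w, False)) z"
          using z e1[OF z] by simp
      qed (use f in \<open>auto simp: PiE_iff\<close>)
      ultimately show "f \<in> (\<lambda>g. \<lambda>z\<in>A. THE w. w \<in> A \<and> g (p (z, True)) = p (w, False)) ` phi ` E"
        unfolding g(2)[symmetric] by (intro image_eqI[of f _ "phi g"] imageI)
    qed
    then show ?thesis
      unfolding image_image by (rule surj_imp_ordLeq)
  qed
  have T: "infinite (A \<rightarrow>\<^sub>E A)" using False finite_A_iff_finite_endos by blast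
  then have E: "infinite E" using T_E card_of_ordLeq_infinite by blast
  have P_E: "|P| \<le>o |E|"
    using card_of_P card_of_Sigma_ordLeq_infinite[OF E T_E, of "\<lambda>_. F"] card_of_mono1[OF F_subset_E]
      ordLeq_transitive by blast
  \<comment> \<open>By Cantor, \<open>E\<close> is strictly larger than \<open>A\<close>. A finite
    \<open>G\<close> would generate at most \<open>|A|\<close> elements, so \<open>G\<close> is
    infinite, and an infinite \<open>G\<close> generates at most \<open>|G|\<close>
    elements.\<close>
  have "|Pow A| \<le>o |A \<rightarrow>\<^sub>E A|"
  proof -
    obtain z1 z2 where z: "z1 \<in> A" "z2 \<in> A" "z1 \<noteq> z2"
      using False by (metis finite.emptyI finite_insert insertCI finite_subset subsetI)
    have "Pow A \<subseteq> (\<lambda>f. {z \<in> A. f z = z1}) ` (A \<rightarrow>\<^sub>E A)"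
    proof
      fix B assume "B \<in> Pow A"
      then show "B \<in> (\<lambda>f. {z \<in> A. f z = z1}) ` (A \<rightarrow>\<^sub>E A)"
        using z by (intro image_eqI[of _ _ "\<lambda>z\<in>A. if z \<in> B then z1 else z2"]) auto
    qed
    then show ?thesis by (rule surj_imp_ordLeq)
  qed
  from ordLess_ordLeq_trans[OF card_of_Pow ordLeq_transitive[OF this T_E]]
  have A_E: "|A| <o |E|" .
  have "infinite G"
  proof
    assume "finite G"
    then have "|G| \<le>o |A|" using False by (rule finite_ordLeq_infinite)
    from card_of_subsemigroup_gen[OF False this, of star] have "|E| \<le>o |A|" unfolding G .
    with A_E show False using not_ordLess_ordLeq by blast
  qed
  from card_of_subsemigroup_gen[OF this ordLeq_refl[OF card_of_Card_order], of star]
  have "|E| \<le>o |G|" unfolding G .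
  with P_E show ?thesis by (rule ordLeq_transitive)
qed

section \<open>Finite semigroups: the exact rank\<close>

definition low_rank :: nat where
  "low_rank = (if card A = 2 then 2 else card A choose 2)"

lemma finite_H_S:
  assumes "finite P"
  shows "finite H" "finite S"
proof -
  have "finite (H \<times> S)"
    using assms finite_subset[of F P] F_P coords_image by (metis finite_imageI subsetI)
  then show "finite H" "finite S"
    using H_nonempty S_nonempty by (auto dest: finite_cartesian_productD1 finite_cartesian_productD2)
qed

lemma small_idempotent_generating_set:
  assumes "finite P"
  obtains G where "G \<subseteq> idempotents star E" "subsemigroup_gen star G = E" "finite G"
    "card G \<le> low_rank + max (card H) (card S)"
proof -
  define n where "n = max (card H) (card S)"
  note fin = finite_H_S[OF assms] and finA = finite_A[OF assms]
  obtain p where p: "p ` {..<n} = H" using surjection_from_lessThan[OF fin(1) H_nonempty, of n] by (auto simp: n_def)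
  obtain q where q: "q ` {..<n} = S" using surjection_from_lessThan[OF fin(2) S_nonempty, of n] by (auto simp: n_def)
  \<comment> \<open>A diagonal of the band: with \<open>p\<close> and \<open>q\<close> onto, these
    elements meet every row and every column, and products of two of them give all of
    \<open>F\<close>.\<close>
  define g where "g i = inv_into F coords (p i, q i)" for i
  have g: "g i \<in> F" "coords (g i) = (p i, q i)" if "i < n" for i
  proof -
    have "(p i, q i) \<in> coords ` F" unfolding coords_image using p q that by blast
    then show "g i \<in> F" "coords (g i) = (p i, q i)"
      unfolding g_def by (rule inv_into_into, rule f_inv_into_f)
  qed
  define G0 where "G0 = g ` {..<n}"
  have G0: "G0 \<subseteq> F" "finite G0" "card G0 \<le> n"
    using g card_image_le[of "{..<n}" g] by (auto simp: G0_def)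
  have F_G0: "F \<subseteq> subsemigroup_gen star G0"
  proof
    fix f assume f: "f \<in> F"
    then have "fst (coords f) \<in> p ` {..<n}" "snd (coords f) \<in> q ` {..<n}"
      using coords_in[OF f] unfolding p q by (simp_all add: mem_Times_iff)
    then obtain i j where ij: "i < n" "j < n" "fst (coords f) = p i" "snd (coords f) = q j"
      by blast
    then have "coords f = coords (star (g i) (g j))"
      using g by (simp add: coords_star prod_eq_iff)
    then have "f = star (g i) (g j)"
      by (rule inj_onD[OF coords_inj _ f star_in_F[OF g(1)[OF ij(1)] g(1)[OF ij(2)]]])
    then show "f \<in> subsemigroup_gen star G0"
      using subsemigroup_gen.mult[OF subsemigroup_gen.incl subsemigroup_gen.incl, of "g i" G0 "g j" star] ij
      by (simp add: G0_def)
  qed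
  obtain T where T: "finite T" "T \<subseteq> collapses A" "card T \<le> low_rank"
      "collapses A \<subseteq> subsemigroup_gen (trans_mult A) T"
    using collapses_small_generating_set[OF finA] unfolding low_rank_def by blast
  have T_idem: "T \<subseteq> idempotents (trans_mult A) (A \<rightarrow>\<^sub>E A)"
    using T(2) collapses_subset_idempotents by blast
  then have T_in: "T \<subseteq> A \<rightarrow>\<^sub>E A" by (auto simp: idempotents_def)
  \<comment> \<open>One lift for each \<open>t\<close> is enough, since \<open>F\<close> yields the
    rest of the fibre by \<open>phi_fibre_sandwich\<close>.\<close>
  have "\<forall>t\<in>T. \<exists>f. f \<in> P \<and> phi f = t" using T_in phi_surj by (metis subsetD)
  then obtain l where l: "\<And>t. t \<in> T \<Longrightarrow> l t \<in> P" "\<And>t. t \<in> T \<Longrightarrow> phi (l t) = t" by metis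
  define G where "G = G0 \<union> l ` T"
  have G_idem: "G \<subseteq> idempotents star E"
    using G0(1) F_subset_idempotents l T_idem unfolding idempotents_E G_def
    by (auto simp: idempotents_star)
  have F_G: "F \<subseteq> subsemigroup_gen star G"
    using F_G0 subsemigroup_gen_mono[of G0 G star] by (auto simp: G_def)
  have "E \<subseteq> subsemigroup_gen star G"
  proof
    fix f assume f: "f \<in> E"
    show "f \<in> subsemigroup_gen star G"
    proof (cases "f \<in> F")
      case False
      then have fP: "f \<in> P" and ninj: "\<not> inj_on (phi f) A" using f E_finite[OF finA] by auto
      have "phi f \<in> subsemigroup_gen (trans_mult A) (collapses A)"
        by (rule singular_in_gen_collapses[OF finA phi_in[OF P_in[OF fP]] ninj])
      then have "phi f \<in> subsemigroup_gen (trans_mult A) T"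
        using subsemigroup_gen_subset_gen[OF T(4)] by blast
      then have "f \<in> subsemigroup_gen star {f \<in> P. phi f \<in> T}"
        using fP phi_vimage_gen[OF T_in] by blast
      moreover have "{f \<in> P. phi f \<in> T} \<subseteq> subsemigroup_gen star G"
      proof
        fix f' assume f': "f' \<in> {f \<in> P. phi f \<in> T}"
        then obtain u v where uv: "u \<in> F" "v \<in> F" "f' = star (star u (l (phi f'))) v"
          using phi_fibre_sandwich[of f' "l (phi f')"] l by auto
        have "l (phi f') \<in> subsemigroup_gen star G"
          using f' by (auto simp: G_def intro: subsemigroup_gen.incl)
        then have "star (star u (l (phi f'))) v \<in> subsemigroup_gen star G"
          using uv(1,2) F_G by (intro subsemigroup_gen.mult[of _ star]) auto
        then show "f' \<in> subsemigroup_gen star G" using uv(3) by simp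
      qed
      ultimately show ?thesis using subsemigroup_gen_subset_gen by blast
    qed (use F_G in blast)
  qed
  moreover have "subsemigroup_gen star G \<subseteq> E"
    using G_idem subsemigroup_gen_mono[of G "idempotents star E" star] gen_idempotents_E by blast
  ultimately have "subsemigroup_gen star G = E" by blast
  moreover have "card G \<le> low_rank + n"
  proof -
    have "card G \<le> card G0 + card (l ` T)" unfolding G_def by (rule card_Un_le)
    also have "\<dots> \<le> n + low_rank"
      using G0(3) card_image_le[OF T(1), of l] T(3) by linarith
    finally show ?thesis by simp
  qed
  ultimately show thesis
    using that[OF G_idem] G0(2) T(1) by (auto simp: G_def n_def)
qed

lemma card_top_generators:
  assumes "finite P" and G: "subsemigroup_gen star G = E"
  shows "max (card H) (card S) \<le> card (G \<inter> F)"
proof -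
  note finA = finite_A[OF assms(1)]
  have fin: "finite (G \<inter> F)" using assms(1) F_P by (auto intro: finite_subset)
  have ex: "\<exists>g1\<in>G \<inter> F. \<exists>g2\<in>G \<inter> F. (h, s) = (fst (coords g1), snd (coords g2))"
    if "h \<in> H" "s \<in> S" for h s
  proof -
    have "(h, s) \<in> coords ` F" using that coords_image by blast
    then obtain f where f: "f \<in> F" "coords f = (h, s)" by auto
    then show ?thesis using F_coords_generators[OF finA G f(1)] by metis
  qed
  obtain h0 s0 where "h0 \<in> H" "s0 \<in> S" using H_nonempty S_nonempty by blast
  then have "H \<subseteq> (\<lambda>g. fst (coords g)) ` (G \<inter> F)" "S \<subseteq> (\<lambda>g. snd (coords g)) ` (G \<inter> F)"
    using ex by fast+
  from this[THEN surj_card_le[OF fin]] show ?thesis by simp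
qed

text \<open>The kernel of a product contains that of its first factor, and leading factors from
  \<open>F\<close> act as the identity on \<open>A\<close>. So the first generator outside
  \<open>F\<close> has its kernel inside that of the product.\<close>

lemma generator_with_smaller_kernel:
  assumes "finite A" and G: "subsemigroup_gen star G = E"
    and f: "f \<in> E" "f \<notin> F"
  obtains g where "g \<in> G - F" "\<And>u v. u \<in> A \<Longrightarrow> v \<in> A \<Longrightarrow> a (g u) = a (g v) \<Longrightarrow> a (f u) = a (f v)"
proof -
  have *: "f \<notin> F \<longrightarrow> (\<exists>g\<in>G - F. \<forall>u\<in>A. \<forall>v\<in>A. a (g u) = a (g v) \<longrightarrow> a (f u) = a (f v))"
    if "f \<in> subsemigroup_gen star G" for f
    using that
  proof induction
    case (incl f)
    then show ?case by blast
  next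
    case (mult x y)
    have xP: "x \<in> P" and yP: "y \<in> P" using mult.hyps G E_subset_P by auto
    show ?case
    proof (cases "x \<in> F")
      case False
      then obtain g where g: "g \<in> G - F" "\<forall>u\<in>A. \<forall>v\<in>A. a (g u) = a (g v) \<longrightarrow> a (x u) = a (x v)"
        using mult.IH(1) by blast
      have "a (star x y u) = a (star x y v)" if "u \<in> A" "v \<in> A" "a (g u) = a (g v)" for u v
      proof -
        have "a (x u) = a (x v)" using g(2) that by blast
        moreover have "u \<in> X" "v \<in> X" using that A_subset by auto
        ultimately show ?thesis by simp
      qed
      then show ?thesis using g(1) by blast
    next
      case True
      have eq: "star x y z = y z" if "z \<in> A" for z
        using that F_apply[OF True] A_subset by auto
      show ?thesis
      proof
        assume "star x y \<notin> F"
        then have "y \<notin> F" using True star_in_F by blast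
        then obtain g where g: "g \<in> G - F" "\<forall>u\<in>A. \<forall>v\<in>A. a (g u) = a (g v) \<longrightarrow> a (y u) = a (y v)"
          using mult.IH(2) by blast
        show "\<exists>g\<in>G - F. \<forall>u\<in>A. \<forall>v\<in>A. a (g u) = a (g v) \<longrightarrow> a (star x y u) = a (star x y v)"
          by (rule bexI[OF _ g(1)], intro ballI impI, subst (1 2) eq) (use g(2) in blast)+
      qed
    qed
  qed
  from f(1) have "f \<in> subsemigroup_gen star G" by (simp add: G)
  from *[OF this] f(2) obtain g where g: "g \<in> G - F" "\<forall>u\<in>A. \<forall>v\<in>A. a (g u) = a (g v) \<longrightarrow> a (f u) = a (f v)"
    by blast
  show thesis by (rule that[OF g(1)]) (rule g(2)[rule_format])
qed

text \<open>For \<open>|A| = 2\<close> both constant maps have the same kernel, so kernels do not see that each of them is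
  needed.\<close>

lemma generator_with_same_phi:
  assumes "card A = 2" and G: "subsemigroup_gen star G = E"
    and f: "f \<in> E" "f \<notin> F"
  obtains g where "g \<in> G - F" "phi g = phi f"
proof -
  have finA: "finite A" using assms(1) card.infinite by fastforce
  have *: "f \<notin> F \<longrightarrow> (\<exists>g\<in>G - F. phi g = phi f)"
    if "f \<in> subsemigroup_gen star G" for f
    using that
  proof induction
    case (incl f)
    then show ?case by blast
  next
    case (mult x y)
    have xE: "x \<in> E" and yE: "y \<in> E" using mult.hyps G by auto
    then have xP: "x \<in> P" and yP: "y \<in> P" using E_subset_P by auto
    have eq: "phi (star x y) = trans_mult A (phi x) (phi y)"
      using phi_star P_in xP yP by blast
    have in_A: "phi x z \<in> A" if "z \<in> A" for z using PiE_mem[OF phi_in[OF P_in[OF xP]] that] .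
    show ?case
    proof (cases "y \<in> F")
      case True
      then have "phi y z = z" if "z \<in> A" for z using that F_apply by simp
      then have "phi (star x y) = phi x"
        unfolding eq using phi_in[OF P_in[OF xP]] in_A by (intro trans_mult_eqI) auto
      moreover have "star x y \<notin> F \<Longrightarrow> x \<notin> F" using True star_in_F by blast
      ultimately show ?thesis using mult.IH(1) by auto
    next
      case False
      then have "\<not> inj_on (phi y) A" using yE E_finite[OF finA] by blast
      then obtain c d where cd: "c \<in> A" "d \<in> A" "c \<noteq> d" "phi y c = phi y d"
        unfolding inj_on_def by blast
      then have "A = {c, d}" using assms(1) by (auto simp: card_2_iff)
      \<comment> \<open>On two points a map that is not injective is constant, hence a right zero,
        so the product keeps the image of its last factor.\<close>
      then have const: "phi y u = phi y v" if "u \<in> A" "v \<in> A" for u v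
        using that cd(4) by (metis insertE singletonD)
      have "phi (star x y) = phi y"
        unfolding eq by (rule trans_mult_eqI[OF phi_in[OF P_in[OF yP]]]) (rule const[OF in_A])
      then show ?thesis using mult.IH(2) False by auto
    qed
  qed
  from f(1) have "f \<in> subsemigroup_gen star G" by (simp add: G)
  from *[OF this] f(2) that show thesis by blast
qed

lemma phi_singular_in_E:
  assumes "finite A" "g \<in> A \<rightarrow>\<^sub>E A" "\<not> inj_on g A"
  obtains f where "f \<in> E" "f \<notin> F" "phi f = g"
proof -
  obtain f where f: "f \<in> P" "phi f = g" using phi_surj[OF assms(2)] .
  then show thesis using that[of f] assms E_finite[OF assms(1)] F_inj_on by auto
qed

lemma card_low_generators:
  assumes "finite A" and "finite G" and G: "subsemigroup_gen star G = E"
  shows "low_rank \<le> card (G - F)"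
proof (cases "card A = 2")
  case True
  \<comment> \<open>Each of the two constant maps needs a generator over it; the description
    operator reads off its constant value.\<close>
  have "A \<subseteq> (\<lambda>g. THE z. \<forall>u\<in>A. phi g u = z) ` (G - F)"
  proof
    fix z assume z: "z \<in> A"
    have "\<not> inj_on (\<lambda>u\<in>A. z) A" using True by (auto simp: card_2_iff inj_on_def)
    then obtain f where f: "f \<in> E" "f \<notin> F" "phi f = (\<lambda>u\<in>A. z)"
      using phi_singular_in_E[OF assms(1), of "\<lambda>u\<in>A. z"] z by auto
    obtain g where g: "g \<in> G - F" "phi g = phi f"
      using generator_with_same_phi[OF True G f(1,2)] .
    have "(THE z'. \<forall>u\<in>A. phi g u = z') = z"
      unfolding g(2) f(3) using z by (intro the_equality) auto
    then show "z \<in> (\<lambda>g. THE z. \<forall>u\<in>A. phi g u = z) ` (G - F)" using g(1) by blast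
  qed
  from surj_card_le[OF finite_Diff[OF assms(2)] this] have "card A \<le> card (G - F)" .
  then show ?thesis using True by (simp add: low_rank_def)
next
  case False
  \<comment> \<open>\<open>K g\<close> collects the points of \<open>A\<close> that
    \<open>phi g\<close> merges with another one. If only one pair is merged, \<open>K g\<close> is
    that pair, so different pairs need different generators.\<close>
  define K where "K g = {x \<in> A. \<exists>y\<in>A. y \<noteq> x \<and> a (g y) = a (g x)}" for g
  have "{B. B \<subseteq> A \<and> card B = 2} \<subseteq> K ` (G - F)"
  proof
    fix B assume "B \<in> {B. B \<subseteq> A \<and> card B = 2}"
    then obtain x y where B: "B = {x, y}" "x \<noteq> y" "x \<in> A" "y \<in> A" by (auto simp: card_2_iff)
    have "collapse A x y x = collapse A x y y" using B by simp
    then have "\<not> inj_on (collapse A x y) A" using B(2-4) by (blast dest: inj_onD)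
    then obtain f where f: "f \<in> E" "f \<notin> F" "phi f = collapse A x y"
      using phi_singular_in_E[OF assms(1), of "collapse A x y"] B by auto
    obtain g where g: "g \<in> G - F"
        "\<And>u v. u \<in> A \<Longrightarrow> v \<in> A \<Longrightarrow> a (g u) = a (g v) \<Longrightarrow> a (f u) = a (f v)"
      using generator_with_smaller_kernel[OF assms(1) G f(1,2)] by blast
    have f_apply: "a (f u) = (if u = x then y else u)" if "u \<in> A" for u
      using fun_cong[OF f(3), of u] that by simp
    have ker: "{u, v} = {x, y}" if "u \<in> A" "v \<in> A" "u \<noteq> v" "a (g u) = a (g v)" for u v
      using g(2)[OF that(1,2,4)] f_apply that by (auto split: if_splits)
    \<comment> \<open>Being in \<open>E\<close> but not in \<open>F\<close>, \<open>g\<close> merges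
      some pair; its kernel lies in that of a collapse, so this pair can only be \<open>x\<close>
      and \<open>y\<close>.\<close>
    have "g \<in> E" using g(1) G by (auto intro: subsemigroup_gen.incl)
    then have "\<not> inj_on (phi g) A" using g(1) E_finite[OF assms(1)] by blast
    then obtain u v where uv: "u \<in> A" "v \<in> A" "u \<noteq> v" "a (g u) = a (g v)"
      by (auto simp: inj_on_def)
    then have gxy: "a (g x) = a (g y)" using ker[OF uv] by (metis doubleton_eq_iff)
    have "K g = B"
    proof
      show "B \<subseteq> K g" using B gxy by (simp add: K_def) metis
      show "K g \<subseteq> B" unfolding K_def B(1) using ker by blast
    qed
    then show "B \<in> K ` (G - F)" using g(1) by blast
  qed
  from surj_card_le[OF finite_Diff[OF assms(2)] this]
  have "card {B. B \<subseteq> A \<and> card B = 2} \<le> card (G - F)" .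
  then show ?thesis using False n_subsets[OF assms(1)] by (simp add: low_rank_def)
qed

lemma card_generating_set:
  assumes "finite P" and G: "subsemigroup_gen star G = E"
  shows "low_rank + max (card H) (card S) \<le> card G"
proof -
  have "G \<subseteq> P" using G E_subset_P by (auto intro: subsemigroup_gen.incl)
  then have fin: "finite G" using assms(1) finite_subset by blast
  have "card G = card (G \<inter> F) + card (G - F)" using card_Int_Diff[OF fin] .
  then show ?thesis
    using card_top_generators[OF assms] card_low_generators[OF finite_A[OF assms(1)] fin G] by linarith
qed

text \<open>One set of idempotents attains both minima, because the lower bound holds for arbitrary
  generating sets.\<close>

theorem rank_finite:
  assumes "finite P"
  shows "semigroup_rank star E =o |{..<low_rank + max (card H) (card S)}|"
    and "semigroup_idrank star E =o |{..<low_rank + max (card H) (card S)}|"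
proof -
  let ?N = "low_rank + max (card H) (card S)"
  obtain G where G: "G \<subseteq> idempotents star E" "subsemigroup_gen star G = E" "finite G" "card G \<le> ?N"
    using small_idempotent_generating_set[OF assms] .
  have le: "|G| \<le>o |{..<?N}|"
    using G(3,4) by (intro card_le_ordLeq) auto
  have ge: "|{..<?N}| \<le>o |G'|" if "G' \<subseteq> E" "subsemigroup_gen star G' = E" for G'
  proof -
    have "finite G'" using that(1) E_subset_P assms by (meson finite_subset)
    then show ?thesis using card_generating_set[OF assms that(2)] by (intro card_le_ordLeq) auto
  qed
  have sub: "idempotents star E \<subseteq> E" by (auto simp: idempotents_def)
  show "semigroup_rank star E =o |{..<?N}|"
    unfolding semigroup_rank_def
    by (rule least_cardinality_eq[OF _ _ le]) (use G sub ge in auto)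
  show "semigroup_idrank star E =o |{..<?N}|"
    unfolding semigroup_idrank_def
    by (rule least_cardinality_eq[OF _ _ le]) (use G sub ge in auto)
qed

theorem rank_infinite:
  assumes "infinite P"
  shows "semigroup_rank star E =o |E|" "semigroup_idrank star E =o |E|" "|E| =o |P|"
proof -
  have E_P: "|E| \<le>o |P|" by (rule card_of_mono1[OF E_subset_P])
  have ge: "|E| \<le>o |G|" if "subsemigroup_gen star G = E" for G
    using E_P infinite_generating_set[OF assms that] by (rule ordLeq_transitive)
  have sub: "idempotents star E \<subseteq> E" by (auto simp: idempotents_def)
  show "semigroup_rank star E =o |E|"
    unfolding semigroup_rank_def
    by (rule least_cardinality_eq[of _ _ E]) (use ge gen_E in auto)
  show "semigroup_idrank star E =o |E|"
    unfolding semigroup_idrank_def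
    by (rule least_cardinality_eq[of _ _ "idempotents star E"])
      (use ge gen_idempotents_E card_of_mono1[OF sub] in auto)
  show "|E| =o |P|"
    using E_P infinite_generating_set[OF assms gen_E] by (simp add: ordIso_iff_ordLeq)
qed

end

theorem theorem3p8:
  fixes X :: "'x set" and Y :: "'y set" and a :: "'y \<Rightarrow> 'x"
    and I :: "'i set" and ai :: "'i \<Rightarrow> 'x"
    and star :: "('x \<Rightarrow> 'y) \<Rightarrow> ('x \<Rightarrow> 'y) \<Rightarrow> 'x \<Rightarrow> 'y"
    and A :: "'x set" and P E D :: "('x \<Rightarrow> 'y) set"
    and lam :: "'i \<Rightarrow> nat"
  assumes "X \<noteq> {}" and "Y \<noteq> {}" and "a \<in> Y \<rightarrow> X"
    and A: "A = a ` Y"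
    and I: "inj_on ai I" "A = ai ` I"
    and lam: "\<And>i. i \<in> I \<Longrightarrow> lam i = card {y \<in> Y. a y = ai i}"
    and star: "star = sandwich_mult X a"
    and P: "P = regular_elements star (X \<rightarrow>\<^sub>E Y)"
    and E: "E = idempotent_generated star (X \<rightarrow>\<^sub>E Y)"
    and D: "D = {f \<in> P. |f ` X| =o |A| }"
  shows "E = {f \<in> P. sandwich_phi Y a f \<in> idempotent_generated (trans_mult A) (A \<rightarrow>\<^sub>E A)}
    \<and> (finite A \<longrightarrow> E = idempotents star D \<union> (P - D))
    \<and> semigroup_rank star E =o semigroup_idrank star E
    \<and> (infinite P \<longrightarrow> semigroup_rank star E =o |E| \<and> |E| =o |P| )
    \<and> (finite P \<longrightarrow> semigroup_rank star E =o
          |{..<(if card A = 2 then 2 else card A choose 2)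
                + max (card_power A (X - A)) (\<Prod>i\<in>I. lam i)}| )"
proof -
  interpret sandwich X Y a A
    by unfold_locales (use assms(2,3) A in auto)
  have P': "sandwich.P X Y a = P" and E': "sandwich.E X Y a = E"
    by (simp_all add: P_def E_def P E star)
  \<comment> \<open>For finite \<open>P\<close> the set \<open>S\<close> is finite and nonempty, so
    all fibres of \<open>a\<close> over \<open>A\<close> are finite and \<open>lam i\<close> is a
    true fibre size.\<close>
  have card_S: "card S = (\<Prod>i\<in>I. lam i)" if "finite P"
  proof -
    have "finite A" using finite_A that P' by simp
    then have "card S = (\<Prod>z\<in>A. card {y \<in> Y. a y = z})"
      unfolding S_def by (rule card_PiE)
    also have "\<dots> = (\<Prod>i\<in>I. card {y \<in> Y. a y = ai i})"
      unfolding I(2) by (simp add: prod.reindex[OF I(1)])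
    also have "\<dots> = (\<Prod>i\<in>I. lam i)" by (simp add: lam)
    finally show ?thesis .
  qed
  have "semigroup_rank star E =o semigroup_idrank star E"
  proof (cases "finite P")
    case True
    then show ?thesis
      using rank_finite ordIso_transitive ordIso_symmetric unfolding P' E' star[symmetric] by blast
  next
    case False
    then show ?thesis
      using rank_infinite ordIso_transitive ordIso_symmetric unfolding P' E' star[symmetric] by blast
  qed
  then show ?thesis
    using E_eq E_eq_top rank_infinite rank_finite(1) card_S
    unfolding P' E' star[symmetric] D low_rank_def H_def card_power_def by simp
qed

end
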